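(* Consider Burgers' equation $u_t+\left(\frac{u^2}{2}\right)_x=0$, $u(x,0)=u_0(x)$, in one space dimension, and suppose that the solution has compact support or satisfies periodic boundary conditions. Let $a>b$ be real numbers with $a\ge u_0(x)\ge b$ for all $x$, and suppose the time step size satisfies $$\Delta t<\lambda\,\Delta x\qquad\text{with}\qquad \lambda=\frac{4}{a-b}.$$ Suppose that at each time level the influence region of each effective troubled cell (ETC) is given by rules I1--I4 of the context, and that all the ETCs are isolated. Then the numerical approximations $u^n=(u^n_j)_j$ produced by the first-order Eulerian--Lagrangian finite volume (EL FV) scheme with merging of influence regions (described in the context) are total variation diminishing (TVD), i.e. $TV(u^{n+1})\le TV(u^n)$ for all $n$, and maximum-principle-preserving (MPP), i.e. $b\le u^n_j\le a$ for all $j$ and all $n>0$.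
   Context: **Mesh.** The space domain is divided into uniform cells $I_j=[x_{j-\frac12},x_{j+\frac12}]$ of length $\Delta x$; $u^n_j$ is the numerical cell average on $I_j$ at time $t^n=n\Delta t$, and $u_j^0$ is the cell average of $u_0$. Either the problem is periodic (cells $I_1,\dots,I_N$, indices modulo $N$) or the data have compact support. $TV(u)=\sum_j|u_{j+1}-u_j|$ (over one period in the periodic case). Below, $u_j=u_j^n$. **Partition lines and fluxes.** From each interface $x_{j+\frac12}$ at time $t^n$ one draws the straight partition line of speed $\nu_{j+\frac12}=\frac{u_j+u_{j+1}}2$; it reaches $x^\star_{j+\frac12}=x_{j+\frac12}+\nu_{j+\frac12}\Delta t$ at time $t^{n+1}$. Set $\alpha_{j+\frac12}=\max\{\frac{u_{j+1}-u_j}{2},0\}$, $F_{j+\frac12}=\frac{u_j^2}2-\nu_{j+\frac12}u_j=\frac{u_{j+1}^2}2-\nu_{j+\frac12}u_{j+1}$, and $\hat F_{j+\frac12}=F_{j+\frac12}-\frac12\alpha_{j+\frac12}(u_{j+1}-u_j)$. **Troubled cells (for $\lambda$).** $I_j$ is a troubled cell of - type I if $u_{j-1}>u_{j+1}+\frac2\lambda$; - type II if it is not of type I, $u_{j-1}>u_j+\frac2\lambda$ and $u_{j-1}\ge u_{j+1}\ge u_j$; - type III if it is not of type I, $u_j>u_{j+1}+\frac2\lambda$ and $u_j\ge u_{j-1}\ge u_{j+1}$; - type IV if it is not of type I or II and $u_{j-1}>u_j+\frac2\lambda$; - type V if it is not of type I or III and $u_j>u_{j+1}+\frac2\lambda$.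 **Effective troubled cells (ETCs).** ETCs are selected sequentially, scanning the cells from left to right: if the first troubled cell found is $I_{j-1}$ and it is of type V, then $I_j$ is declared an ETC; otherwise $I_{j-1}$ itself is declared an ETC. Troubled cells adjacent to a selected ETC are treated together with it (only the ETC generates an influence region). Once an ETC and its influence region have been determined, the scan continues to the right from the right boundary cell of that influence region. **Influence region.** Let $I_j$ be an ETC and let the values on $I_{j-3},\dots,I_{j+3}$ be $s_\ell,z_\ell,z_1,z_2,z_3,z_r,s_r$. Put $A=z_1+z_2+z_3$. The influence region of $I_j$ consists of: - I1: $I_{j-2},\dots,I_{j+1}$, if $I_j$ is of type IV (in which case $I_{j-1}$ is of type V); - I2: $I_{j-2},\dots,I_{j+3}$, if $A>\frac{7a+5b}4$ and ($z_r<\frac{a+3b}4$ or $s_r+z_r<\frac{a+3b}2$); - I3: $I_{j-3},\dots,I_{j+2}$, if $A<\frac{5a+7b}4$ and ($z_\ell>\frac{3a+b}4$ or $s_\ell+z_\ell>\frac{3a+b}2$); - I4: $I_{j-2},\dots,I_{j+2}$, in all other cases. An ETC is isolated if its influence region does not overlap the influence region of any other ETC. **Scheme (one time step).** Each influence region is merged into a single cell; all other cells are kept. Let $K=[x_{p-\frac12},x_{q+\frac12}]=I_p\cup\dots\cup I_q$ be a cell of the new mesh ($p=q$ for an unmerged cell). The partition lines and numerical fluxes at its two end points are the original ones (computed from the original values $u_j$). With $K^\star=[x^\star_{p-\frac12},x^\star_{q+\frac12}]$ and $|K^\star|=(q-p+1)\Delta x+(\nu_{q+\frac12}-\nu_{p-\frac12})\Delta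 t$, the value $u^\star_K$ on $K^\star$ at time $t^{n+1}$ is defined by $$|K^\star|\,u^\star_K=\Delta x\sum_{i=p}^q u_i-\Delta t\left(\hat F_{q+\frac12}-\hat F_{p-\frac12}\right).$$ Finally the piecewise constant function $u^\star$ equal to $u_K^\star$ on $K^\star$ is $L^2$-projected onto piecewise constants on the original mesh: $u_j^{n+1}=\frac1{\Delta x}\int_{I_j}u^\star(x)\,dx$. *)

theory Defs
  imports "HOL-Analysis.Analysis"
begin

text \<open>
  Grid functions are indexed by all integers: in the periodic case a grid function is the
  \<open>N\<close>-periodic extension of its values on the cells \<open>1, \<dots>, N\<close>.
  The half-integer index \<open>j + 1/2\<close> of an interface is represented by \<open>j\<close>, so that the
  interfaces of the cell \<open>j\<close> are \<open>j - 1\<close> and \<open>j\<close>; the cell \<open>1\<close> starts at \<open>x0\<close>.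
\<close>

datatype boundary = Periodic nat | Compact_Support

definition boundary_condition :: "boundary \<Rightarrow> real \<Rightarrow> (real \<Rightarrow> real) \<Rightarrow> bool" where
  "boundary_condition B dx f = (case B of
      Periodic N \<Rightarrow> N \<ge> 1 \<and> (\<forall>x. f (x + real N * dx) = f x)
    | Compact_Support \<Rightarrow> compact (closure {x. f x \<noteq> 0}))"

definition edge :: "real \<Rightarrow> real \<Rightarrow> int \<Rightarrow> real" where
  "edge x0 dx j = x0 + of_int j * dx"

definition cell_average :: "real \<Rightarrow> real \<Rightarrow> (real \<Rightarrow> real) \<Rightarrow> int \<Rightarrow> real" where
  "cell_average x0 dx f j = (1 / dx) * integral {edge x0 dx (j - 1)..edge x0 dx j} f"

text \<open>The values are taken in \<^typ>\<open>ennreal\<close> so that the sum over all cells is meaningful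
  without a summability assumption.\<close>

definition TV :: "boundary \<Rightarrow> (int \<Rightarrow> real) \<Rightarrow> ennreal" where
  "TV B u = (case B of
      Periodic N \<Rightarrow> (\<Sum>j\<in>{1..int N}. ennreal \<bar>u (j + 1) - u j\<bar>)
    | Compact_Support \<Rightarrow> (\<Sum>\<^sub>\<infinity>j\<in>UNIV. ennreal \<bar>u (j + 1) - u j\<bar>))"


subsection \<open>Partition lines and fluxes\<close>

definition nu :: "(int \<Rightarrow> real) \<Rightarrow> int \<Rightarrow> real" where
  "nu u j = (u j + u (j + 1)) / 2"

definition edge_star :: "real \<Rightarrow> real \<Rightarrow> real \<Rightarrow> (int \<Rightarrow> real) \<Rightarrow> int \<Rightarrow> real" where
  "edge_star x0 dx dt u j = edge x0 dx j + nu u j * dt"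

definition alpha :: "(int \<Rightarrow> real) \<Rightarrow> int \<Rightarrow> real" where
  "alpha u j = max ((u (j + 1) - u j) / 2) 0"

definition flux :: "(int \<Rightarrow> real) \<Rightarrow> int \<Rightarrow> real" where
  "flux u j = (u j)\<^sup>2 / 2 - nu u j * u j"

definition flux_hat :: "(int \<Rightarrow> real) \<Rightarrow> int \<Rightarrow> real" where
  "flux_hat u j = flux u j - 1 / 2 * alpha u j * (u (j + 1) - u j)"


subsection \<open>Troubled cells\<close>

definition type_I :: "real \<Rightarrow> (int \<Rightarrow> real) \<Rightarrow> int \<Rightarrow> bool" where
  "type_I lam u j \<longleftrightarrow> u (j - 1) > u (j + 1) + 2 / lam"

definition type_II :: "real \<Rightarrow> (int \<Rightarrow> real) \<Rightarrow> int \<Rightarrow> bool" where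
  "type_II lam u j \<longleftrightarrow> \<not> type_I lam u j \<and> u (j - 1) > u j + 2 / lam
     \<and> u (j - 1) \<ge> u (j + 1) \<and> u (j + 1) \<ge> u j"

definition type_III :: "real \<Rightarrow> (int \<Rightarrow> real) \<Rightarrow> int \<Rightarrow> bool" where
  "type_III lam u j \<longleftrightarrow> \<not> type_I lam u j \<and> u j > u (j + 1) + 2 / lam
     \<and> u j \<ge> u (j - 1) \<and> u (j - 1) \<ge> u (j + 1)"

definition type_IV :: "real \<Rightarrow> (int \<Rightarrow> real) \<Rightarrow> int \<Rightarrow> bool" where
  "type_IV lam u j \<longleftrightarrow> \<not> type_I lam u j \<and> \<not> type_II lam u j \<and> u (j - 1) > u j + 2 / lam"

definition type_V :: "real \<Rightarrow> (int \<Rightarrow> real) \<Rightarrow> int \<Rightarrow> bool" where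
  "type_V lam u j \<longleftrightarrow> \<not> type_I lam u j \<and> \<not> type_III lam u j \<and> u j > u (j + 1) + 2 / lam"

definition troubled :: "real \<Rightarrow> (int \<Rightarrow> real) \<Rightarrow> int \<Rightarrow> bool" where
  "troubled lam u j \<longleftrightarrow> type_I lam u j \<or> type_II lam u j \<or> type_III lam u j
     \<or> type_IV lam u j \<or> type_V lam u j"


subsection \<open>Influence regions and effective troubled cells\<close>

text \<open>A pair \<open>(p, q)\<close> stands for the block of cells \<open>p, \<dots>, q\<close>.
  The four branches are the rules I1, I2, I3 and I4. The conditions of I2 and I3 exclude each
  other when \<open>b < a\<close>, so their order is immaterial.\<close>

definition influence_region ::
    "real \<Rightarrow> real \<Rightarrow> real \<Rightarrow> (int \<Rightarrow> real) \<Rightarrow> int \<Rightarrow> int \<times> int" where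
  "influence_region a b lam u j =
    (let sl = u (j - 3); zl = u (j - 2); z1 = u (j - 1); z2 = u j; z3 = u (j + 1);
         zr = u (j + 2); sr = u (j + 3); A = z1 + z2 + z3
     in if type_IV lam u j then (j - 2, j + 1)
        else if A > (7 * a + 5 * b) / 4 \<and>
                (zr < (a + 3 * b) / 4 \<or> sr + zr < (a + 3 * b) / 2) then (j - 2, j + 3)
        else if A < (5 * a + 7 * b) / 4 \<and>
                (zl > (3 * a + b) / 4 \<or> sl + zl > (3 * a + b) / 2) then (j - 3, j + 2)
        else (j - 2, j + 2))"

fun block :: "int \<times> int \<Rightarrow> int set" where
  "block (p, q) = {p..q}"

text \<open>All periodic copies of the cells in \<open>E\<close>.\<close>

definition copies :: "boundary \<Rightarrow> int set \<Rightarrow> int set" where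
  "copies B E = (case B of
      Periodic N \<Rightarrow> {e + k * int N | e k. e \<in> E}
    | Compact_Support \<Rightarrow> E)"

lemma influence_region_right: "j + 1 \<le> snd (influence_region a b lam u j)"
  by (simp add: influence_region_def Let_def)

text \<open>
  \<open>etc_scan B a b lam u r j E\<close> scans the cells \<open>j, \<dots>, r\<close> from left to right, where \<open>E\<close> is the
  set of the ETCs selected so far. A troubled cell adjacent to an already selected
  ETC generates no ETC of its own. After an ETC has been selected, the next cell to be inspected
  is the right boundary cell of its influence region.
\<close>

function etc_scan ::
    "boundary \<Rightarrow> real \<Rightarrow> real \<Rightarrow> real \<Rightarrow> (int \<Rightarrow> real) \<Rightarrow> int \<Rightarrow> int \<Rightarrow> int set \<Rightarrow> int set" where
  "etc_scan B a b lam u r j E =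
    (if j > r then E
     else if troubled lam u j \<and> \<not> (\<exists>e\<in>copies B E. \<bar>e - j\<bar> \<le> 1) then
       (let e = (if type_V lam u j then j + 1 else j)
        in etc_scan B a b lam u r (snd (influence_region a b lam u e)) (insert e E))
     else etc_scan B a b lam u r (j + 1) E)"
  by pat_completeness auto
termination
proof (relation "Wellfounded.measure (\<lambda>(B, a, b, lam, u, r, j, E). nat (r + 1 - j))")
  fix B a b lam r j E e and u :: "int \<Rightarrow> real"
  assume "\<not> r < j" and e: "e = (if type_V lam u j then j + 1 else j)"
  moreover have "j + 1 \<le> snd (influence_region a b lam u e)"
    using influence_region_right[of e a b lam u] e by (auto split: if_splits)
  ultimately show "((B, a, b, lam, u, r, snd (influence_region a b lam u e), insert e E),
      (B, a, b, lam, u, r, j, E)) \<in> Wellfounded.measure (\<lambda>(B, a, b, lam, u, r, j, E). nat (r + 1 - j))"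
    by simp
qed auto

declare etc_scan.simps [simp del]

text \<open>
  In the periodic case the scan runs over the cells \<open>1, \<dots>, N\<close> and all periodic copies of the
  selected cells are included. For data of compact support only finitely many cells are troubled,
  and the scan runs from the first to the last of them.
\<close>

definition ETC :: "boundary \<Rightarrow> real \<Rightarrow> real \<Rightarrow> real \<Rightarrow> (int \<Rightarrow> real) \<Rightarrow> int set" where
  "ETC B a b lam u = (case B of
      Periodic N \<Rightarrow> copies B (etc_scan B a b lam u (int N) 1 {})
    | Compact_Support \<Rightarrow>
        (let T = {j. troubled lam u j}
         in if T = {} then {} else etc_scan B a b lam u (Max T) (Min T) {}))"

text \<open>In the periodic case, \<open>e'\<close> may be a periodic copy of \<open>e\<close>: an influence region must not
  overlap itself across the period.\<close>

definition isolated_ETC :: "boundary \<Rightarrow> real \<Rightarrow> real \<Rightarrow> real \<Rightarrow> (int \<Rightarrow> real) \<Rightarrow> int \<Rightarrow> bool" where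
  "isolated_ETC B a b lam u e \<longleftrightarrow>
    (\<forall>e'\<in>ETC B a b lam u. e' \<noteq> e \<longrightarrow>
       block (influence_region a b lam u e) \<inter> block (influence_region a b lam u e') = {})"


subsection \<open>The scheme\<close>

definition merged_mesh ::
    "boundary \<Rightarrow> real \<Rightarrow> real \<Rightarrow> real \<Rightarrow> (int \<Rightarrow> real) \<Rightarrow> (int \<times> int) set" where
  "merged_mesh B a b lam u =
    (let R = influence_region a b lam u ` ETC B a b lam u
     in R \<union> {(j, j) | j. j \<notin> (\<Union>K\<in>R. block K)})"

text \<open>Half-open, so that the sets \<open>cell_star\<close> of neighbouring cells are disjoint.\<close>

fun cell_star :: "real \<Rightarrow> real \<Rightarrow> real \<Rightarrow> (int \<Rightarrow> real) \<Rightarrow> int \<times> int \<Rightarrow> real set" where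
  "cell_star x0 dx dt u (p, q) = {edge_star x0 dx dt u (p - 1)..<edge_star x0 dx dt u q}"

fun cell_star_length :: "real \<Rightarrow> real \<Rightarrow> (int \<Rightarrow> real) \<Rightarrow> int \<times> int \<Rightarrow> real" where
  "cell_star_length dx dt u (p, q) = of_int (q - p + 1) * dx + (nu u q - nu u (p - 1)) * dt"

fun cell_star_value :: "real \<Rightarrow> real \<Rightarrow> (int \<Rightarrow> real) \<Rightarrow> int \<times> int \<Rightarrow> real" where
  "cell_star_value dx dt u (p, q) =
    (dx * (\<Sum>i\<in>{p..q}. u i) - dt * (flux_hat u q - flux_hat u (p - 1)))
      / cell_star_length dx dt u (p, q)"

definition u_star :: "boundary \<Rightarrow> real \<Rightarrow> real \<Rightarrow> real \<Rightarrow> real \<Rightarrow> real \<Rightarrow> real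
    \<Rightarrow> (int \<Rightarrow> real) \<Rightarrow> real \<Rightarrow> real" where
  "u_star B a b lam x0 dx dt u x =
    cell_star_value dx dt u (THE K. K \<in> merged_mesh B a b lam u \<and> x \<in> cell_star x0 dx dt u K)"

definition el_fv_step :: "boundary \<Rightarrow> real \<Rightarrow> real \<Rightarrow> real \<Rightarrow> real \<Rightarrow> real \<Rightarrow> real
    \<Rightarrow> (int \<Rightarrow> real) \<Rightarrow> int \<Rightarrow> real" where
  "el_fv_step B a b lam x0 dx dt u = cell_average x0 dx (u_star B a b lam x0 dx dt u)"

primrec el_fv :: "boundary \<Rightarrow> real \<Rightarrow> real \<Rightarrow> real \<Rightarrow> real \<Rightarrow> real \<Rightarrow> real
    \<Rightarrow> (real \<Rightarrow> real) \<Rightarrow> nat \<Rightarrow> int \<Rightarrow> real" where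
  "el_fv B a b lam x0 dx dt u0 0 = cell_average x0 dx u0"
| "el_fv B a b lam x0 dx dt u0 (Suc n) =
     el_fv_step B a b lam x0 dx dt (el_fv B a b lam x0 dx dt u0 n)"

end

theory Submission
  imports Defs
begin

text \<open>
  Let \<open>lin u\<close> be the piecewise linear interpolant of the cell values. For every block
  \<open>K = p, \<dots>, q\<close> of the merged mesh, the value \<open>u\<^sup>*\<^sub>K\<close> lies between the minimum and the maximum
  of \<open>lin u\<close> over the interval from interface to interface, so it equals \<open>lin u (xi\<^sub>K)\<close> for a point
  \<open>xi\<^sub>K\<close> of that interval. Hence \<open>u\<^sup>* = lin u \<circ> xi\<close> with \<open>xi\<close> monotone, which gives the maximum
  principle. If \<open>V\<close> is the cumulated variation of \<open>u\<close>, then \<open>V \<circ> xi + u\<^sup>*\<close> and \<open>V \<circ> xi - u\<^sup>*\<close>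
  are monotone, so the jumps of the cell averages of \<open>u\<^sup>*\<close> are dominated by those of \<open>V \<circ> xi\<close>,
  which telescope.

  For the upper bound of \<open>u\<^sup>*\<^sub>K\<close> by \<open>c\<close>, write \<open>(u\<^sup>*\<^sub>K - c) |K\<^sup>*|\<close> as a sum over the cells of
  \<open>u\<^sub>i - c \<le> 0\<close> and two edge terms, quadratic in \<open>u - c\<close>. The drop of size more than \<open>2 / \<lambda>\<close> inside an
  influence region makes the sum negative enough to absorb the edge terms. The lower bound follows by
  the reflection \<open>u\<^sub>i \<mapsto> - u\<^sub>-\<^sub>i\<close>, which preserves the equation.
\<close>


subsection \<open>Bounds for the value on a block\<close>

text \<open>Minus the corrected flux as a function of the two values at an interface: the product
  belongs to a shock, where \<open>alpha\<close> vanishes, the sum of squares to a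
  rarefaction.\<close>

definition edge_term :: "real \<Rightarrow> real \<Rightarrow> real" where
  "edge_term x y = (if x \<ge> y then x * y / 2 else (x\<^sup>2 + y\<^sup>2) / 4)"

text \<open>The term \<open>c\<^sup>2 / 2\<close> does not depend on the interface, so it cancels in flux differences.\<close>

lemma flux_hat_eq_edge_term: "- flux_hat u j - c * nu u j = edge_term (u j - c) (u (j + 1) - c) - c\<^sup>2 / 2"
  by (simp add: flux_hat_def flux_def alpha_def nu_def edge_term_def max_def power2_eq_square field_simps)

text \<open>Here \<open>z\<close> and \<open>s\<close> are the shifted values inside and outside the
  left end. At a shock the left side is \<open>z * (r - s)\<close> with
  \<open>r - s \<ge> h\<close>; at a rarefaction the edge term has a favourable sign.\<close>

lemma left_edge_bound:
  assumes "z \<le> 0" "s \<le> r - h" "h \<le> r"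
  shows "r * z - 2 * edge_term s z \<le> z * h"
proof (cases "s \<ge> z")
  case True
  have "z * (r - s - h) \<le> 0"
    using assms by (intro mult_nonpos_nonneg) auto
  with True show ?thesis by (simp add: edge_term_def algebra_simps)
next
  case False
  have "z * (r - h) \<le> 0"
    using assms by (intro mult_nonpos_nonneg) auto
  moreover have "edge_term s z \<ge> 0" using False by (simp add: edge_term_def)
  ultimately show ?thesis by (simp add: algebra_simps)
qed

text \<open>At a shock the left side is \<open>z * (r + s)\<close>. At a rarefaction
  \<open>s + z \<le> 0\<close> gives \<open>\<bar>s\<bar> \<le> \<bar>z\<bar>\<close>, and
  \<open>z * (r + z)\<close> remains as an upper bound.\<close>

lemma right_edge_bound:
  assumes "z \<le> 0" "s + z \<le> 0" "- (r + h) \<le> z" "- (r + h) \<le> s"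
  shows "r * z + 2 * edge_term z s \<le> - z * h"
proof (cases "z \<ge> s")
  case True
  have "z * (r + s + h) \<le> 0"
    using assms by (intro mult_nonpos_nonneg) auto
  with True show ?thesis by (simp add: edge_term_def algebra_simps)
next
  case False
  have "z * (r + z + h) \<le> 0"
    using assms by (intro mult_nonpos_nonneg) auto
  moreover have "s\<^sup>2 \<le> z\<^sup>2"
    using assms False by (intro abs_le_square_iff[THEN iffD1]) auto
  ultimately show ?thesis using False by (simp add: edge_term_def field_simps power2_eq_square)
qed

text \<open>The three differences bounded by \<open>r\<close> are those of an untroubled cell.
  Squares at a rarefaction are compared first; then a product of \<open>w\<close> with a nonnegative
  factor remains.\<close>

lemma bound_cell:
  assumes "0 \<le> r" "w \<le> 0" "t + w \<le> 0" "s \<le> w + r" "w \<le> t + r" "s \<le> t + r"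
  shows "r * w + 2 * (edge_term w t - edge_term s w) \<le> 0"
proof -
  have sq: "t\<^sup>2 \<le> w\<^sup>2" if "w < t"
    using assms that by (intro abs_le_square_iff[THEN iffD1]) auto
  have sq': "w\<^sup>2 \<le> s\<^sup>2" if "s < w"
    using assms that by (intro abs_le_square_iff[THEN iffD1]) auto
  have 1: "w * (r + t - s) \<le> 0" and 2: "w * (r + t - w) \<le> 0" and 3: "w * (r + w - s) \<le> 0"
    using assms by (auto intro!: mult_nonpos_nonneg)
  have 4: "r * w \<le> 0" if "s < w" "w < t"
    using assms that by (intro mult_nonneg_nonpos) auto
  show ?thesis
  proof (cases "w \<ge> t"; cases "s \<ge> w")
    assume "w \<ge> t" "s \<ge> w" then show ?thesis using 1 by (simp add: edge_term_def field_simps)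
  next
    assume "w \<ge> t" "\<not> s \<ge> w" then show ?thesis using 2 sq'
      by (simp add: edge_term_def field_simps power2_eq_square)
  next
    assume "\<not> w \<ge> t" "s \<ge> w" then show ?thesis using 3 sq
      by (simp add: edge_term_def field_simps power2_eq_square)
  next
    assume "\<not> w \<ge> t" "\<not> s \<ge> w" then show ?thesis using 4 sq sq'
      by (simp add: edge_term_def field_simps)
  qed
qed

text \<open>\<open>W\<close> is the sum over the three central cells, \<open>z\<close> and
  \<open>s\<close> are the values inside and outside the right end. Either \<open>W\<close> pays for
  the loss \<open>- z * h\<close>, or \<open>z\<close> is so moderate that the right edge costs at
  most \<open>r * r\<close>, which \<open>W \<le> - r\<close> pays.\<close>

lemma bound_short_right:
  assumes "z \<le> 0" "s + z \<le> 0" "- (r + h) \<le> z" "- (r + h) \<le> s" "0 \<le> h" "h \<le> r" "W \<le> - r"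
    and "W \<le> r / 2 - 3 * h \<or> z \<ge> - (r / 2) - h \<and> s + z \<ge> - r - 2 * h"
  shows "r * W + (r * z + 2 * edge_term z s) \<le> 0"
proof -
  have rW: "r * W \<le> - (r * r)"
    using mult_left_mono[of W "- r" r] assms by simp
  have hr: "h * h \<le> r * r"
    using assms by (intro mult_mono) auto
  show ?thesis
  proof (cases "W \<le> r / 2 - 3 * h")
    case True
    have rW': "r * W \<le> r * (r / 2 - 3 * h)"
      using True assms by (intro mult_left_mono) auto
    have "- z * h \<le> (r + h) * h"
      using assms by (intro mult_right_mono) auto
    moreover have "r * W + (r + h) * h \<le> 0"
    \<comment> \<open>For small \<open>h\<close> the bound \<open>W \<le> - r\<close> suffices; for
      large \<open>h\<close> the other bound on \<open>W\<close> leaves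
      \<open>(r - h) * (r - h) - r * r / 2\<close>.\<close>
    proof (cases "h \<le> r / 2")
      case True
      then have "(r + h) * h \<le> (r + r) * (r / 2)"
        using assms by (intro mult_mono) auto
      with rW show ?thesis by simp
    next
      case False
      then have "(r - h) * (r - h) \<le> r * (r / 2)"
        using assms by (intro mult_mono) auto
      then show ?thesis using rW' by (simp add: algebra_simps)
    qed
    ultimately show ?thesis using right_edge_bound[OF assms(1-4)] by linarith
  next
    case False
    then have *: "z \<ge> - (r / 2) - h" "s + z \<ge> - r - 2 * h" using assms by auto
    have "r * z + 2 * edge_term z s \<le> r * r"
    proof (cases "z \<ge> s")
      case True
      have "z * (s + z + r + 2 * h) \<le> 0"
        using * assms by (intro mult_nonpos_nonneg) auto
      moreover have "0 \<le> (z + h) * (z + h)" by simp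
      ultimately show ?thesis using True hr by (simp add: edge_term_def algebra_simps)
    next
      case False
      have sq: "s\<^sup>2 \<le> z\<^sup>2"
        using assms False by (intro abs_le_square_iff[THEN iffD1]) auto
      have "z * (r + z) \<le> r * r"
      proof (cases "r + z \<ge> 0")
        case True
        then have "z * (r + z) \<le> 0" using assms by (intro mult_nonpos_nonneg) auto
        moreover have "0 \<le> r * r" by simp
        ultimately show ?thesis by linarith
      next
        case False
        then have "(- z) * (- z - r) \<le> (2 * r) * (r / 2)"
          using * assms by (intro mult_mono) auto
        then show ?thesis by (simp add: algebra_simps)
      qed
      then show ?thesis using sq False by (simp add: edge_term_def field_simps power2_eq_square)
    qed
    with rW show ?thesis by linarith
  qed
qed

text \<open>The block reaches one cell further, of value \<open>y\<close>. The negated condition of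
  the short block makes \<open>y\<close> so negative that, together with \<open>W\<close>, it
  compensates the loss \<open>- z * h\<close>.\<close>

lemma bound_long_right:
  assumes "z \<le> 0" "s + z \<le> 0" "- (r + h) \<le> z" "- (r + h) \<le> s" "0 \<le> h" "h \<le> r" "W \<le> - r"
    and "y < - (r / 2) - h \<or> y + z < - r - 2 * h"
  shows "r * W + r * y + (r * z + 2 * edge_term z s) \<le> 0"
proof -
  have rW: "r * W \<le> - (r * r)"
    using mult_left_mono[of W "- r" r] assms by simp
  have hr: "h * h \<le> r * r"
    using assms by (intro mult_mono) auto
  have "- (r * r) + r * y - z * h \<le> 0"
  proof (cases "y < - (r / 2) - h")
    case True
    then have "r * y \<le> r * (- (r / 2) - h)"
      using assms by (intro mult_left_mono) auto
    moreover have "- z * h \<le> (r + h) * h"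
      using assms by (intro mult_right_mono) auto
    ultimately have "- (r * r) + r * y - z * h \<le> - (3 / 2) * (r * r) + h * h"
      by (simp add: algebra_simps)
    with hr zero_le_square[of r] show ?thesis by linarith
  next
    case False
    then have "r * y \<le> r * (- r - 2 * h - z)"
      using assms by (intro mult_left_mono) auto
    moreover have "- z * (r + h) \<le> (r + h) * (r + h)"
      using assms by (intro mult_right_mono) auto
    ultimately show ?thesis using hr by (simp add: algebra_simps)
  qed
  then show ?thesis using rW right_edge_bound[OF assms(1-4)] by linarith
qed

text \<open>With \<open>r = 2 / \<lambda>\<close>, the left-hand side below has the sign of \<open>u\<^sup>*\<^sub>K - c\<close> at the limiting
  time step \<open>\<Delta>t = \<lambda> \<Delta>x\<close>; smaller time steps are interpolated linearly between this and
  \<open>\<Delta>t = 0\<close>.\<close>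

definition value_bounded :: "real \<Rightarrow> (int \<Rightarrow> real) \<Rightarrow> int \<Rightarrow> int \<Rightarrow> real \<Rightarrow> bool" where
  "value_bounded r u p q c \<longleftrightarrow>
    r * (\<Sum>i\<in>{p..q}. u i - c)
      + 2 * (edge_term (u q - c) (u (q + 1) - c) - edge_term (u (p - 1) - c) (u p - c)) \<le> 0"

definition reflect :: "(int \<Rightarrow> real) \<Rightarrow> int \<Rightarrow> real" where
  "reflect u i = - u (- i)"

text \<open>With \<open>b = m - r\<close> and \<open>a = m + r\<close>, the negations of the conditions of I2 and, by reflection,
  I3.\<close>

definition short_right :: "real \<Rightarrow> real \<Rightarrow> (int \<Rightarrow> real) \<Rightarrow> int \<Rightarrow> bool" where
  "short_right m r u e \<longleftrightarrow> u (e - 1) + u e + u (e + 1) \<le> 3 * m + r / 2 \<or>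
    u (e + 2) \<ge> m - r / 2 \<and> u (e + 3) + u (e + 2) \<ge> 2 * m - r"

definition short_left :: "real \<Rightarrow> real \<Rightarrow> (int \<Rightarrow> real) \<Rightarrow> int \<Rightarrow> bool" where
  "short_left m r u e \<longleftrightarrow> short_right (- m) r (reflect u) (- e)"

definition has_drop :: "real \<Rightarrow> (int \<Rightarrow> real) \<Rightarrow> int \<Rightarrow> bool" where
  "has_drop r u e \<longleftrightarrow> u (e - 1) > u (e + 1) + r \<or> u (e - 1) > u e + r \<or> u e > u (e + 1) + r"

text \<open>The third alternative covers I2, I3 and I4. In the second one the disjunction makes
  the notion invariant under reflection.\<close>

definition admissible_block :: "real \<Rightarrow> real \<Rightarrow> (int \<Rightarrow> real) \<Rightarrow> int \<Rightarrow> int \<Rightarrow> bool" where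
  "admissible_block m r u p q \<longleftrightarrow>
    q = p \<and> \<not> has_drop r u p \<or>
    q = p + 3 \<and> u (p + 1) > u (p + 2) + r \<and> (u (p + 3) > u (p + 1) \<or> u p < u (p + 2)) \<or>
    (\<exists>e. has_drop r u e \<and> p = (if short_left m r u e then e - 2 else e - 3)
       \<and> q = (if short_right m r u e then e + 2 else e + 3))"

section \<open>Reflection of admissible blocks\<close>

lemma has_drop_reflect: "has_drop r (reflect u) (- e) = has_drop r u e"
  by (auto simp: has_drop_def reflect_def algebra_simps)

lemma reflect_reflect [simp]: "reflect (reflect u) = u"
  by (simp add: reflect_def fun_eq_iff)

text \<open>The mirror image exchanges the two ends: the two alternatives for four cells change
  places, and so do \<open>short_left\<close> and \<open>short_right\<close>.\<close>

lemma admissible_block_reflect: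
  assumes "admissible_block m r u p q"
  shows "admissible_block (- m) r (reflect u) (- q) (- p)"
proof -
  consider "q = p \<and> \<not> has_drop r u p"
    | "q = p + 3 \<and> u (p + 1) > u (p + 2) + r \<and> (u (p + 3) > u (p + 1) \<or> u p < u (p + 2))"
    | e where "has_drop r u e" "p = (if short_left m r u e then e - 2 else e - 3)"
       "q = (if short_right m r u e then e + 2 else e + 3)"
    using assms unfolding admissible_block_def by blast
  then show ?thesis
  proof cases
    case 1
    then show ?thesis by (simp add: admissible_block_def has_drop_reflect)
  next
    case 2
    then show ?thesis by (auto simp: admissible_block_def reflect_def add.commute)
  next
    case 3
    then have "has_drop r (reflect u) (- e)
      \<and> - q = (if short_left (- m) r (reflect u) (- e) then - e - 2 else - e - 3)
      \<and> - p = (if short_right (- m) r (reflect u) (- e) then - e + 2 else - e + 3)"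
      by (auto simp: has_drop_reflect short_left_def)
    then show ?thesis unfolding admissible_block_def by blast
  qed
qed

section \<open>Upper bounds for each kind of block\<close>

lemma value_bounded_cell:
  assumes "0 \<le> r" and "\<not> has_drop r u p" and "u p \<le> c" and "(u p + u (p + 1)) / 2 \<le> c"
  shows "value_bounded r u p p c"
  unfolding value_bounded_def
  using bound_cell[of r "u p - c" "u (p + 1) - c" "u (p - 1) - c"] assms
  by (auto simp: has_drop_def)

text \<open>The lower cell of the drop contributes \<open>- r * r\<close>, the edges cost
  \<open>w p * h - w (p + 3) * h\<close>. A high last cell makes the right edge cheap; a low first
  cell turns the left edge into a gain.\<close>

lemma value_bounded_four:
  assumes "u (p + 1) > u (p + 2) + r" and "u (p + 3) > u (p + 1) \<or> u p < u (p + 2)"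
    and ran: "\<And>i. m - r \<le> u i \<and> u i \<le> m + r" and c: "c \<le> m + r"
    and le: "\<And>i. p \<le> i \<Longrightarrow> i \<le> p + 3 \<Longrightarrow> u i \<le> c" and mid: "(u (p + 3) + u (p + 4)) / 2 \<le> c"
  shows "value_bounded r u p (p + 3) c"
proof -
  define w where "w i = u i - c" for i
  define h where "h = c - m"
  have w_le: "w p \<le> 0" "w (p + 1) \<le> 0" "w (p + 2) \<le> 0" "w (p + 3) \<le> 0"
    using le by (auto simp: w_def)
  have w_ge: "- (r + h) \<le> w i" for i using ran[of i] by (simp add: w_def h_def)
  \<comment> \<open>The drop starts at a value of at most \<open>c\<close> and ends at one of at
    least \<open>m - r\<close>, hence \<open>c \<ge> m\<close>.\<close>
  have h: "0 \<le> h" "h \<le> r"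
    using ran[of "p + 2"] assms(1) le[of "p + 1"] c by (auto simp: h_def)
  have w2: "w (p + 2) \<le> - r" using assms(1) le[of "p + 1"] by (simp add: w_def)
  have hr: "h * h \<le> r * r" using h by (intro mult_mono) auto
  have L: "r * w p - 2 * edge_term (w (p - 1)) (w p) \<le> w p * h"
    using ran[of "p - 1"] w_le h by (intro left_edge_bound) (auto simp: w_def h_def)
  have R: "r * w (p + 3) + 2 * edge_term (w (p + 3)) (w (p + 4)) \<le> - w (p + 3) * h"
    using w_le w_ge mid by (intro right_edge_bound) (auto simp: w_def)
  have r1: "r * w (p + 1) \<le> 0" using h w_le by (intro mult_nonneg_nonpos) auto
  have r2: "r * w (p + 2) \<le> r * - r" using h w2 by (intro mult_left_mono) auto
  have core: "- (r * r) + w p * h - w (p + 3) * h \<le> 0"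
    using assms(2)
  proof
    assume "u (p + 3) > u (p + 1)"
    then have "- w (p + 3) \<le> h" using w_ge[of "p + 2"] assms(1) by (simp add: w_def)
    then have "- w (p + 3) * h \<le> h * h" using h by (intro mult_right_mono)
    moreover have "w p * h \<le> 0" using h w_le by (intro mult_nonpos_nonneg) auto
    ultimately show ?thesis using hr by simp
  next
    assume "u p < u (p + 2)"
    then have "w p * h \<le> - r * h" using w2 h by (intro mult_right_mono) (auto simp: w_def)
    moreover have "- w (p + 3) * h \<le> (r + h) * h"
      using h w_ge[of "p + 3"] by (intro mult_right_mono) auto
    ultimately show ?thesis using hr by (simp add: algebra_simps)
  qed
  have "{p..p + 3} = {p, p + 1, p + 2, p + 3}" by auto
  then have "(\<Sum>i\<in>{p..p + 3}. u i - c) = w p + w (p + 1) + w (p + 2) + w (p + 3)"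
    by (simp add: w_def)
  then show ?thesis
    using L R r1 r2 core unfolding value_bounded_def w_def[symmetric]
    by (simp add: distrib_left add.assoc)
qed

text \<open>The left edge costs nothing, so both left ends are treated alike. The drop puts one of
  the three central cells at least \<open>r\<close> below \<open>c\<close>, which helps to pay for
  the right edge.\<close>

lemma value_bounded_drop:
  assumes drop: "has_drop r u e"
    and p: "p \<in> {e - 3, e - 2}" and q: "q = (if short_right m r u e then e + 2 else e + 3)"
    and ran: "\<And>i. m - r \<le> u i \<and> u i \<le> m + r" and c: "c \<le> m + r"
    and le: "\<And>i. p \<le> i \<Longrightarrow> i \<le> q \<Longrightarrow> u i \<le> c" and mid: "(u q + u (q + 1)) / 2 \<le> c"
  shows "value_bounded r u p q c"
proof -
  define w where "w i = u i - c" for i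
  define h where "h = c - m"
  have w_le: "w i \<le> 0" if "p \<le> i" "i \<le> q" for i
    using le that by (auto simp: w_def)
  have w_ge: "- (r + h) \<le> w i" for i using ran[of i] by (simp add: w_def h_def)
  have le3: "u (e - 1) \<le> c" "u e \<le> c" "u (e + 1) \<le> c"
    using le[of "e - 1"] le[of e] le[of "e + 1"] p q by (auto split: if_splits)
  have h: "0 \<le> h" "h \<le> r"
    using drop ran[of e] ran[of "e + 1"] le3 c by (auto simp: h_def has_drop_def)
  define W where "W = w (e - 1) + w e + w (e + 1)"
  have W: "W \<le> - r"
    using drop le3 by (auto simp: W_def w_def has_drop_def)
  have L: "r * w p - 2 * edge_term (w (p - 1)) (w p) \<le> w p * h"
    using ran[of "p - 1"] w_le[of p] p q h
    by (intro left_edge_bound) (auto simp: w_def h_def split: if_splits)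
  have "w p * h \<le> 0"
    using h w_le[of p] p q by (intro mult_nonpos_nonneg) (auto split: if_splits)
  with L have L: "r * w p - 2 * edge_term (w (p - 1)) (w p) \<le> 0" by linarith
  have r2: "r * w (e - 2) \<le> 0"
    using h w_le[of "e - 2"] p q by (intro mult_nonneg_nonpos) (auto split: if_splits)
  have "{e - 2..e + 1} = {e - 2, e - 1, e, e + 1}" "{e - 3..e + 1} = {e - 3, e - 2, e - 1, e, e + 1}"
    by auto
  then have left: "r * (\<Sum>i\<in>{p..e + 1}. w i) - 2 * edge_term (w (p - 1)) (w p) \<le> r * W"
    using p L r2 by (auto simp: W_def algebra_simps)
  show ?thesis
  proof (cases "short_right m r u e")
    case True
    then have q: "q = e + 2" using q by simp
    have "r * W + (r * w (e + 2) + 2 * edge_term (w (e + 2)) (w (e + 3))) \<le> 0"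
      using True w_le[of "e + 2"] w_ge mid p h W unfolding q
      by (intro bound_short_right) (auto simp: short_right_def w_def W_def h_def add.commute)
    moreover have "(\<Sum>i\<in>{p..q}. w i) = w (e + 2) + (\<Sum>i\<in>{p..e + 1}. w i)"
    proof -
      have "{p..q} = insert (e + 2) {p..e + 1}" using p q by auto
      then show ?thesis by simp
    qed
    ultimately show ?thesis
      using left unfolding value_bounded_def w_def[symmetric] by (simp add: q algebra_simps)
  next
    case False
    then have q: "q = e + 3" using q by simp
    have "r * W + r * w (e + 2) + (r * w (e + 3) + 2 * edge_term (w (e + 3)) (w (e + 4))) \<le> 0"
      using False w_le[of "e + 3"] w_ge mid p h W unfolding q
      by (intro bound_long_right) (auto simp: short_right_def w_def W_def h_def add.commute)
    moreover have "(\<Sum>i\<in>{p..q}. w i) = w (e + 3) + (w (e + 2) + (\<Sum>i\<in>{p..e + 1}. w i))"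
    proof -
      have "{p..q} = insert (e + 3) (insert (e + 2) {p..e + 1})" using p q by auto
      then show ?thesis by simp
    qed
    ultimately show ?thesis
      using left unfolding value_bounded_def w_def[symmetric] by (simp add: q algebra_simps)
  qed
qed

lemma value_bounded_admissible:
  assumes "admissible_block m r u p q" and "0 \<le> r"
    and "\<And>i. m - r \<le> u i \<and> u i \<le> m + r" and "c \<le> m + r"
    and "\<And>i. p \<le> i \<Longrightarrow> i \<le> q \<Longrightarrow> u i \<le> c" and "(u q + u (q + 1)) / 2 \<le> c"
  shows "value_bounded r u p q c"
proof -
  consider "q = p \<and> \<not> has_drop r u p"
    | "q = p + 3 \<and> u (p + 1) > u (p + 2) + r \<and> (u (p + 3) > u (p + 1) \<or> u p < u (p + 2))"
    | e where "has_drop r u e" "p \<in> {e - 3, e - 2}"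
       "q = (if short_right m r u e then e + 2 else e + 3)"
    using assms(1) unfolding admissible_block_def by (auto split: if_splits)
  then show ?thesis
  proof cases
    case 1
    then show ?thesis using assms(2) assms(5)[of p] assms(6) by (auto intro: value_bounded_cell)
  next
    case 2
    then show ?thesis using assms(3-6) value_bounded_four[of u p r m c] by (auto simp: add.commute)
  next
    case 3
    then show ?thesis using assms(3-6) by (intro value_bounded_drop)
  qed
qed

text \<open>After subtracting \<open>c\<close> times the length, the numerator is
  \<open>dx * S + dt * D\<close>: a combination of \<open>S\<close> and \<open>r * S + 2 * D\<close>
  with the nonnegative weights \<open>dx - r * dt / 2\<close> and \<open>dt / 2\<close>.\<close>

lemma numerator_nonpos:
  assumes "value_bounded r u p q c" and "\<And>i. p \<le> i \<Longrightarrow> i \<le> q \<Longrightarrow> u i \<le> c"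
    and "0 \<le> dt" "r * dt \<le> 2 * dx" "p \<le> q"
  shows "dx * (\<Sum>i\<in>{p..q}. u i) - dt * (flux_hat u q - flux_hat u (p - 1))
    \<le> c * cell_star_length dx dt u (p, q)"
proof -
  define S where "S = (\<Sum>i\<in>{p..q}. u i - c)"
  define D where "D = edge_term (u q - c) (u (q + 1) - c) - edge_term (u (p - 1) - c) (u p - c)"
  have "S \<le> 0" unfolding S_def using assms(2) by (intro sum_nonpos) auto
  then have "(dx - r * dt / 2) * S \<le> 0"
    using assms(4) by (intro mult_nonneg_nonpos) auto
  moreover have "(dt / 2) * (r * S + 2 * D) \<le> 0"
    using assms(1,3) unfolding value_bounded_def S_def D_def by (intro mult_nonneg_nonpos) auto
  ultimately have "dx * S + dt * D \<le> 0" by (simp add: algebra_simps)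
  moreover have "S = (\<Sum>i\<in>{p..q}. u i) - c * of_int (q - p + 1)"
    using \<open>p \<le> q\<close> by (simp add: S_def sum_subtractf of_nat_nat)
  moreover have "D = - (flux_hat u q - flux_hat u (p - 1)) - c * (nu u q - nu u (p - 1))"
    using flux_hat_eq_edge_term[of u q c] flux_hat_eq_edge_term[of u "p - 1" c] by (simp add: D_def algebra_simps)
  ultimately show ?thesis by (simp add: algebra_simps)
qed

text \<open>Interface \<open>j\<close> sits at \<open>j + 1 / 2\<close>; its mirror image at
  \<open>- j - 1 / 2\<close> has index \<open>- j - 1\<close>. Hence the shift by one.\<close>

lemma nu_reflect: "nu (reflect u) (- j) = - nu u (j - 1)"
  by (simp add: nu_def reflect_def field_simps)

lemma flux_hat_reflect: "flux_hat (reflect u) (- j) = flux_hat u (j - 1)"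
  by (simp add: flux_hat_def flux_def alpha_def nu_def reflect_def max_def power2_eq_square field_simps)

lemma sum_reflect: "(\<Sum>i\<in>{- q..- p}. reflect u i) = - (\<Sum>i\<in>{p..q}. u i)"
  unfolding reflect_def sum_negf
  by (rule arg_cong[where f = uminus], rule sum.reindex_bij_witness[of _ uminus uminus]) auto

lemma cell_star_value_reflect:
  "cell_star_value dx dt (reflect u) (- q, - p) = - cell_star_value dx dt u (p, q)"
  "cell_star_length dx dt (reflect u) (- q, - p) = cell_star_length dx dt u (p, q)"
  using nu_reflect[of u p] nu_reflect[of u "q + 1"] flux_hat_reflect[of u p] flux_hat_reflect[of u "q + 1"]
  by (simp_all add: sum_reflect minus_divide_left) (simp_all add: algebra_simps)


subsection \<open>Interpolation, cumulated variation and cell averages\<close>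

text \<open>The centre of the cell \<open>j\<close> is placed at the integer \<open>j\<close>, hence its right interface at
  \<open>j + 1 / 2\<close>.\<close>

definition lin :: "(int \<Rightarrow> real) \<Rightarrow> real \<Rightarrow> real" where
  "lin f t = f \<lfloor>t\<rfloor> + frac t * (f (\<lfloor>t\<rfloor> + 1) - f \<lfloor>t\<rfloor>)"

lemma lin_of_int [simp]: "lin f (of_int j) = f j"
  by (simp add: lin_def)

lemma lin_half: "lin f (of_int j + 1 / 2) = (f j + f (j + 1)) / 2"
proof -
  have "\<lfloor>of_int j + 1 / 2 :: real\<rfloor> = j" by linarith
  then show ?thesis by (simp add: lin_def frac_def field_simps)
qed

lemma lin_add: "lin (\<lambda>j. f j + g j) t = lin f t + lin g t"
  by (simp add: lin_def algebra_simps)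

lemma lin_diff: "lin (\<lambda>j. f j - g j) t = lin f t - lin g t"
  by (simp add: lin_def algebra_simps)

lemma lin_linear: "lin (\<lambda>j. k * of_int j) t = k * t"
  by (simp add: lin_def frac_def algebra_simps)

lemma lin_shift: "lin f (t + of_int k) = lin (\<lambda>j. f (j + k)) t"
  by (simp add: lin_def frac_def add.assoc add.commute[of k])

lemma lin_const: "lin (\<lambda>j. k) t = k"
  by (simp add: lin_def)

lemma lin_mono:
  assumes "\<And>j. f j \<le> f (j + 1)"
  shows "mono (lin f)"
proof
  have f: "f i \<le> f j" if "i \<le> j" for i j
    using that by (induction rule: int_ge_induct) (auto intro: order_trans assms)
  fix s t :: real assume "s \<le> t"
  show "lin f s \<le> lin f t"
  proof (cases "\<lfloor>s\<rfloor> = \<lfloor>t\<rfloor>")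
    case True
    then have "frac s \<le> frac t" using \<open>s \<le> t\<close> by (simp add: frac_def)
    then show ?thesis
      using True assms by (auto simp: lin_def intro!: mult_right_mono)
  next
    case False
    then have *: "\<lfloor>s\<rfloor> + 1 \<le> \<lfloor>t\<rfloor>" using floor_mono[OF \<open>s \<le> t\<close>] by linarith
    have "frac s * (f (\<lfloor>s\<rfloor> + 1) - f \<lfloor>s\<rfloor>) \<le> 1 * (f (\<lfloor>s\<rfloor> + 1) - f \<lfloor>s\<rfloor>)"
      using assms frac_lt_1[of s] by (intro mult_right_mono) auto
    then have "lin f s \<le> f (\<lfloor>s\<rfloor> + 1)" by (simp add: lin_def)
    also have "\<dots> \<le> f \<lfloor>t\<rfloor>" using f * by blast
    also have "\<dots> \<le> lin f t" using assms by (simp add: lin_def)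
    finally show ?thesis .
  qed
qed

lemma lin_le:
  assumes "\<And>j. f j \<le> g j"
  shows "lin f t \<le> lin g t"
proof -
  have "lin h t = (1 - frac t) * h \<lfloor>t\<rfloor> + frac t * h (\<lfloor>t\<rfloor> + 1)" for h
    by (simp add: lin_def algebra_simps)
  then show ?thesis
    using assms frac_lt_1[of t] by (auto intro!: add_mono mult_left_mono)
qed

lemma lin_continuous:
  assumes M: "\<And>j. \<bar>f (j + 1) - f j\<bar> \<le> M"
  shows "continuous_on S (lin f)"
proof -
  \<comment> \<open>Adding the slope \<open>M\<close> makes the interpolants of \<open>f\<close> and
    \<open>- f\<close> nondecreasing, which yields a Lipschitz bound.\<close>
  have "mono (lin (\<lambda>j. M * of_int j + f j))" "mono (lin (\<lambda>j. M * of_int j - f j))"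
    using M by (auto intro!: lin_mono simp: algebra_simps abs_le_iff)
  then have mono: "mono (\<lambda>t. M * t + lin f t)" "mono (\<lambda>t. M * t - lin f t)"
    unfolding lin_add lin_diff lin_linear .
  have le: "\<bar>lin f t - lin f s\<bar> \<le> M * (t - s)" if "s \<le> t" for s t
    using monoD[OF mono(1) that] monoD[OF mono(2) that] by (simp add: abs_le_iff algebra_simps)
  have "M-lipschitz_on S (lin f)"
  proof (rule lipschitz_onI)
    show "dist (lin f x) (lin f y) \<le> M * dist x y" for x y
      using le[of x y] le[of y x] by (cases "x \<le> y") (auto simp: dist_real_def abs_minus_commute)
    show "0 \<le> M" using M[of 0] by linarith
  qed
  then show ?thesis by (rule lipschitz_on_continuous_on)
qed

text \<open>At most one of the sums is nonempty: variation is counted from cell 0, negatively to its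
  left, so no convergence at infinity is involved.\<close>

definition cumulated_variation :: "(int \<Rightarrow> real) \<Rightarrow> int \<Rightarrow> real" where
  "cumulated_variation u j =
    (\<Sum>i\<in>{0..<j}. \<bar>u (i + 1) - u i\<bar>) - (\<Sum>i\<in>{j..<0}. \<bar>u (i + 1) - u i\<bar>)"

lemma cumulated_variation_step:
  "cumulated_variation u (j + 1) = cumulated_variation u j + \<bar>u (j + 1) - u j\<bar>"
proof (cases "0 \<le> j")
  case True
  then have "{0..<j + 1} = insert j {0..<j}" "{j..<0} = {}" "{j + 1..<0} = {}" by auto
  then show ?thesis by (simp add: cumulated_variation_def)
next
  case False
  then have "{j..<0} = insert j {j + 1..<0}" "{0..<j} = {}" "{0..<j + 1} = {}" by auto
  then show ?thesis by (simp add: cumulated_variation_def)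
qed

lemma sum_telescope_int:
  fixes f :: "int \<Rightarrow> real"
  assumes "i \<le> j"
  shows "(\<Sum>k\<in>{i..<j}. f (k + 1) - f k) = f j - f i"
  using assms
proof (induction rule: int_ge_induct)
  case (step j)
  then have "{i..<j + 1} = insert j {i..<j}" by auto
  with step show ?case by simp
qed simp

lemma cumulated_variation_diff:
  assumes "i \<le> j"
  shows "cumulated_variation u j - cumulated_variation u i = (\<Sum>k\<in>{i..<j}. \<bar>u (k + 1) - u k\<bar>)"
  by (simp add: sum_telescope_int[OF assms, symmetric] cumulated_variation_step)

text \<open>The Jordan decomposition of the interpolant: each increment of the variation dominates
  those of \<open>u\<close> and \<open>- u\<close>.\<close>

lemma mono_cumulated_variation:
  "mono (lin (cumulated_variation u))"
  "mono (\<lambda>t. lin (cumulated_variation u) t + lin u t)"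
  "mono (\<lambda>t. lin (cumulated_variation u) t - lin u t)"
  unfolding lin_add[symmetric] lin_diff[symmetric]
  by (auto intro!: lin_mono simp: cumulated_variation_step)

text \<open>Both averages are compared with the value of \<open>f\<close> at the common
  interface.\<close>

lemma cell_average_shift_mono:
  assumes "mono f" "dx > 0"
  shows "cell_average x0 dx f j \<le> cell_average x0 dx f (j + 1)"
proof -
  have int: "f integrable_on {c..d}" for c d
    using assms(1) by (intro integrable_on_mono_on) (auto simp: mono_on_def mono_def)
  have edge: "edge x0 dx (j + 1) = edge x0 dx j + dx" "edge x0 dx j = edge x0 dx (j - 1) + dx"
    by (auto simp: edge_def algebra_simps)
  have "integral {edge x0 dx (j - 1)..edge x0 dx j} f \<le> f (edge x0 dx j) * dx"
    using integral_le[OF int[of "edge x0 dx (j - 1)" "edge x0 dx j"],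
        of "\<lambda>x. f (edge x0 dx j)", OF integrable_const_ivl] assms(2) edge monoD[OF assms(1)]
    by (simp add: mult.commute)
  also have "\<dots> \<le> integral {edge x0 dx j..edge x0 dx (j + 1)} f"
    using integral_le[of "\<lambda>x. f (edge x0 dx j)", OF integrable_const_ivl int[of "edge x0 dx j" "edge x0 dx (j + 1)"]]
      assms(2) edge monoD[OF assms(1)]
    by (simp add: mult.commute)
  finally show ?thesis
    using assms(2) by (simp add: cell_average_def divide_right_mono)
qed

lemma cell_average_bounds:
  assumes "dx > 0" "\<And>c d. f integrable_on {c..d}"
    and "\<And>x. edge x0 dx (j - 1) \<le> x \<Longrightarrow> x \<le> edge x0 dx j \<Longrightarrow> b \<le> f x \<and> f x \<le> a"
  shows "b \<le> cell_average x0 dx f j" "cell_average x0 dx f j \<le> a"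
proof -
  have edge: "edge x0 dx j = edge x0 dx (j - 1) + dx"
    by (auto simp: edge_def algebra_simps)
  have "b * dx \<le> integral {edge x0 dx (j - 1)..edge x0 dx j} f"
    using integral_le[of "\<lambda>x. b", OF integrable_const_ivl assms(2)[of "edge x0 dx (j - 1)" "edge x0 dx j"]]
      assms edge by (simp add: mult.commute)
  then show "b \<le> cell_average x0 dx f j"
    using assms(1) by (simp add: cell_average_def field_simps)
  have "integral {edge x0 dx (j - 1)..edge x0 dx j} f \<le> a * dx"
    using integral_le[OF assms(2)[of "edge x0 dx (j - 1)" "edge x0 dx j"], of "\<lambda>x. a", OF integrable_const_ivl]
      assms edge by (simp add: mult.commute)
  then show "cell_average x0 dx f j \<le> a"
    using assms(1) by (simp add: cell_average_def field_simps)
qed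

lemma cell_average_add:
  assumes "\<And>c d. f integrable_on {c..d}" "\<And>c d. g integrable_on {c..d}"
  shows "cell_average x0 dx (\<lambda>x. f x + g x) j = cell_average x0 dx f j + cell_average x0 dx g j"
  using assms by (simp add: cell_average_def integral_add distrib_left add_divide_distrib)

lemma cell_average_diff:
  assumes "\<And>c d. f integrable_on {c..d}" "\<And>c d. g integrable_on {c..d}"
  shows "cell_average x0 dx (\<lambda>x. f x - g x) j = cell_average x0 dx f j - cell_average x0 dx g j"
  using assms by (simp add: cell_average_def integral_diff right_diff_distrib diff_divide_distrib)

lemma cell_average_translate:
  "cell_average x0 dx f (j + k) = cell_average x0 dx (\<lambda>x. f (x + of_int k * dx)) j"
proof -
  have "edge x0 dx (j + k - 1) = edge x0 dx (j - 1) + of_int k * dx"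
    "edge x0 dx (j + k) = edge x0 dx j + of_int k * dx"
    by (auto simp: edge_def algebra_simps)
  then show ?thesis
    using integral_shift_Icc_real[where a = "edge x0 dx (j - 1)" and b = "edge x0 dx j" and c = "of_int k * dx" and f = f]
    by (simp add: cell_average_def o_def add.commute)
qed


subsection \<open>Effective troubled cells\<close>

text \<open>Outside type I, types II and IV together exhaust the drop from \<open>j - 1\<close> to
  \<open>j\<close>, types III and V the drop from \<open>j\<close> to \<open>j + 1\<close>.\<close>

lemma troubled_iff_has_drop: "troubled lam u j \<longleftrightarrow> has_drop (2 / lam) u j"
  by (auto simp: troubled_def has_drop_def type_I_def type_II_def type_III_def type_IV_def type_V_def)

text \<open>If \<open>u (j + 1)\<close> were at most \<open>u (j - 1)\<close>, it would either be at
  least \<open>u j\<close>, giving type II, or lie below \<open>u j\<close>, giving type I.\<close>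

lemma type_IV_D:
  assumes "type_IV lam u j"
  shows "u (j - 1) > u j + 2 / lam" "u (j + 1) > u (j - 1)"
  using assms by (auto simp: type_IV_def type_I_def type_II_def)

lemma troubled_shift: "troubled lam u (j + k) = troubled lam (\<lambda>i. u (i + k)) j"
  by (simp add: troubled_iff_has_drop has_drop_def algebra_simps)

lemma influence_region_shift:
  "influence_region a b lam u (j + k) =
    map_prod (\<lambda>i. i + k) (\<lambda>i. i + k) (influence_region a b lam (\<lambda>i. u (i + k)) j)"
proof -
  have e: "j + k - 3 = j - 3 + k" "j + k - 2 = j - 2 + k" "j + k - 1 = j - 1 + k"
    "j + k + 1 = j + 1 + k" "j + k + 2 = j + 2 + k" "j + k + 3 = j + 3 + k"
    by auto
  show ?thesis
    unfolding influence_region_def Let_def type_I_def type_II_def type_IV_def e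
    by (simp only: if_distrib[of "map_prod _ _"] map_prod_simp)
qed

text \<open>In terms of the midpoint and half width of the range, the two ends are chosen
  independently, because the bounds on the central sum in I2 and I3 contradict each other.\<close>

lemma influence_region_I234:
  assumes "\<not> type_IV lam u j" "b < a"
  shows "influence_region a b lam u j =
    (if short_left ((a + b) / 2) ((a - b) / 2) u j then j - 2 else j - 3,
     if short_right ((a + b) / 2) ((a - b) / 2) u j then j + 2 else j + 3)"
proof -
  let ?A = "u (j - 1) + u j + u (j + 1)"
  have R: "\<not> short_right ((a + b) / 2) ((a - b) / 2) u j \<longleftrightarrow> ?A > (7 * a + 5 * b) / 4 \<and>
      (u (j + 2) < (a + 3 * b) / 4 \<or> u (j + 3) + u (j + 2) < (a + 3 * b) / 2)"
    unfolding short_right_def by (auto simp: field_simps not_le)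
  have e: "reflect u (- j - 1) + reflect u (- j) + reflect u (- j + 1) = - ?A"
    "reflect u (- j + 2) = - u (j - 2)" "reflect u (- j + 3) = - u (j - 3)"
    by (simp_all add: reflect_def add.commute)
  have L: "\<not> short_left ((a + b) / 2) ((a - b) / 2) u j \<longleftrightarrow> ?A < (5 * a + 7 * b) / 4 \<and>
      (u (j - 2) > (3 * a + b) / 4 \<or> u (j - 3) + u (j - 2) > (3 * a + b) / 2)"
    unfolding short_left_def short_right_def e by (auto simp: field_simps not_le)
  have "\<not> (?A > (7 * a + 5 * b) / 4 \<and> ?A < (5 * a + 7 * b) / 4)" using assms(2) by auto
  then show ?thesis
    using assms(1) R L unfolding influence_region_def Let_def by (auto split: if_splits)
qed

lemma influence_region_bounds:
  assumes "b < a" "influence_region a b lam u j = (p, q)"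
  shows "p \<le> j - 2" "j + 1 \<le> q" "p + 3 \<le> q" "q \<le> p + 6"
  using assms influence_region_I234[of lam u j b a]
  by (cases "type_IV lam u j"; auto simp: influence_region_def split: if_splits)+

lemma admissible_influence_region:
  assumes "b < a" "lam = 4 / (a - b)" "troubled lam u j" "influence_region a b lam u j = (p, q)"
  shows "admissible_block ((a + b) / 2) ((a - b) / 2) u p q"
proof (cases "type_IV lam u j")
  case True
  with assms(4) have "p = j - 2" "q = j + 1" by (auto simp: influence_region_def)
  moreover have "u (j - 1) > u j + (a - b) / 2"
    using type_IV_D(1)[OF True] unfolding assms(2) by (simp add: field_simps)
  ultimately show ?thesis using type_IV_D(2)[OF True] by (simp add: admissible_block_def add.commute)
next
  case False
  let ?m = "(a + b) / 2" and ?r = "(a - b) / 2"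
  have "2 / lam = ?r" using assms(2) by simp
  then have "has_drop ?r u j" using assms(3) by (simp only: troubled_iff_has_drop)
  moreover have "p = (if short_left ?m ?r u j then j - 2 else j - 3)"
    "q = (if short_right ?m ?r u j then j + 2 else j + 3)"
    using influence_region_I234[OF False assms(1)] assms(4) by auto
  ultimately show ?thesis unfolding admissible_block_def by blast
qed

lemma admissible_untroubled:
  assumes "lam = 4 / (a - b)" "\<not> troubled lam u j"
  shows "admissible_block ((a + b) / 2) ((a - b) / 2) u j j"
proof -
  have "2 / lam = (a - b) / 2" using assms(1) by simp
  then show ?thesis using assms(2) by (simp only: admissible_block_def troubled_iff_has_drop simp_thms)
qed

lemma subset_copies: "E \<subseteq> copies B E"
proof
  fix e assume "e \<in> E"
  then have "\<exists>e' k. e = e' + k * int N \<and> e' \<in> E" for N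
    by (intro exI[of _ e] exI[of _ 0]) auto
  then show "e \<in> copies B E" using \<open>e \<in> E\<close> by (auto simp: copies_def split: boundary.split)
qed

lemma copies_mono: "E \<subseteq> E' \<Longrightarrow> copies B E \<subseteq> copies B E'"
  by (auto simp: copies_def split: boundary.split)

lemma etc_scan_superset: "E \<subseteq> etc_scan B a b lam u r j E"
proof (induction B a b lam u r j E rule: etc_scan.induct)
  case (1 B a b lam u r j E)
  then show ?case
    by (subst etc_scan.simps) (auto simp: Let_def split: if_splits)
qed

text \<open>A drop from \<open>j\<close> to \<open>j + 1\<close> is seen from both cells, so the
  right neighbour of a type V cell is troubled as well.\<close>

lemma etc_scan_troubled:
  assumes "\<And>e. e \<in> E \<Longrightarrow> troubled lam u e" "e \<in> etc_scan B a b lam u r j E"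
  shows "troubled lam u e"
  using assms
proof (induction B a b lam u r j E rule: etc_scan.induct)
  case (1 B a b lam u r j E)
  have V: "troubled lam u (j + 1)" if "type_V lam u j"
    using that by (auto simp: troubled_iff_has_drop has_drop_def type_V_def)
  show ?case
  proof (cases "r < j")
    case True
    with 1 show ?thesis by (simp add: etc_scan.simps)
  next
    case False
    show ?thesis
    proof (cases "troubled lam u j \<and> \<not> (\<exists>e\<in>copies B E. \<bar>e - j\<bar> \<le> 1)")
      case True
      show ?thesis
        by (rule "1.IH"(1)[OF False True refl])
          (use "1.prems" True False V in \<open>auto simp: etc_scan.simps[of B a b lam u r j E] Let_def split: if_splits\<close>)
    next
      case nT: False
      show ?thesis
        by (rule "1.IH"(2)[OF False nT])
          (use "1.prems" nT False in \<open>auto simp: etc_scan.simps[of B a b lam u r j E] split: if_splits\<close>)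
    qed
  qed
qed

text \<open>The scan passes over a troubled cell in two ways: by jumping to the end of a region that
  contains it, or because an ETC at distance at most one exists, whose region contains both its
  neighbours.\<close>

lemma etc_scan_covers:
  assumes "b < a" "troubled lam u k" "j \<le> k" "k \<le> r"
  shows "\<exists>e\<in>copies B (etc_scan B a b lam u r j E). k \<in> block (influence_region a b lam u e)"
  using assms
proof (induction B a b lam u r j E rule: etc_scan.induct)
  case (1 B a b lam u r j E)
  then have r: "\<not> r < j" by simp
  show ?case
  proof (cases "troubled lam u j \<and> \<not> (\<exists>e\<in>copies B E. \<bar>e - j\<bar> \<le> 1)")
    case True
    define e where "e = (if type_V lam u j then j + 1 else j)"
    obtain p q where pq: "influence_region a b lam u e = (p, q)" by force
    have eq: "etc_scan B a b lam u r j E = etc_scan B a b lam u r q (insert e E)"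
      using True r pq by (subst etc_scan.simps) (simp add: e_def[symmetric])
    show ?thesis
    proof (cases "q \<le> k")
      case True': True
      show ?thesis
        using "1.IH"(1)[OF r True e_def] True' "1.prems" pq eq by simp
    next
      case False
      then have "k \<in> block (p, q)"
        using influence_region_bounds[OF _ pq] "1.prems" by (auto simp: e_def split: if_splits)
      moreover have "e \<in> copies B (etc_scan B a b lam u r j E)"
        using etc_scan_superset[of "insert e E" B a b lam u r q] subset_copies eq by blast
      ultimately show ?thesis using pq by metis
    qed
  next
    case nT: False
    have eq: "etc_scan B a b lam u r j E = etc_scan B a b lam u r (j + 1) E"
      using nT r by (subst etc_scan.simps) auto
    show ?thesis
    proof (cases "k = j")
      case True
      then obtain e where e: "e \<in> copies B E" "\<bar>e - k\<bar> \<le> 1" using nT "1.prems" by auto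
      obtain p q where pq: "influence_region a b lam u e = (p, q)" by force
      have "k \<in> block (p, q)"
        using influence_region_bounds[OF _ pq] "1.prems" e by auto
      moreover have "e \<in> copies B (etc_scan B a b lam u r j E)"
        using copies_mono[OF etc_scan_superset] e by blast
      ultimately show ?thesis using pq by metis
    next
      case False
      then show ?thesis using "1.IH"(2)[OF r nT] "1.prems" eq by simp
    qed
  qed
qed


subsection \<open>The merged mesh\<close>

text \<open>Discrete counterpart of \<open>boundary_condition\<close>, propagated from step to
  step.\<close>

definition grid_condition :: "boundary \<Rightarrow> (int \<Rightarrow> real) \<Rightarrow> bool" where
  "grid_condition B u = (case B of
      Periodic N \<Rightarrow> N \<ge> 1 \<and> (\<forall>j. u (j + int N) = u j)
    | Compact_Support \<Rightarrow> finite {j. u j \<noteq> 0})"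

lemma periodic_multiple:
  assumes "\<And>j::int. u (j + n) = u j"
  shows "u (j + k * n) = u j"
proof (induction k rule: int_induct[where k = 0])
  case (step1 i)
  then show ?case using assms[of "j + i * n"] by (simp add: algebra_simps)
next
  case (step2 i)
  then show ?case using assms[of "j + (i - 1) * n"] by (simp add: algebra_simps)
qed simp

text \<open>One time step in isolation; \<open>range\<close> and \<open>grid\<close> are the
  invariants that the step reproduces.\<close>

locale el_step =
  fixes B :: boundary and a b lam x0 dx dt :: real and u :: "int \<Rightarrow> real"
  assumes dx: "dx > 0" and dt: "dt > 0" and ab: "b < a" and lam: "lam = 4 / (a - b)"
    and cfl: "dt < lam * dx" and range: "b \<le> u j" "u j \<le> a"
    and grid: "grid_condition B u"
    and isolated: "e \<in> ETC B a b lam u \<Longrightarrow> isolated_ETC B a b lam u e"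
begin

abbreviation "region \<equiv> influence_region a b lam u"
abbreviation "etcs \<equiv> ETC B a b lam u"
abbreviation "mesh \<equiv> merged_mesh B a b lam u"

lemma periodic: "B = Periodic N \<Longrightarrow> u (j + k * int N) = u j"
  using grid periodic_multiple[of u "int N" j k] by (simp add: grid_condition_def)

lemma region_periodic:
  assumes "B = Periodic N"
  shows "region (e + k * int N) = map_prod (\<lambda>i. i + k * int N) (\<lambda>i. i + k * int N) (region e)"
  using influence_region_shift[of a b lam u e "k * int N"] periodic[OF assms] by simp

lemma troubled_periodic: "B = Periodic N \<Longrightarrow> troubled lam u (j + k * int N) = troubled lam u j"
  using troubled_shift[of lam u j "k * int N"] periodic by simp

lemma etcs_periodic:
  assumes "B = Periodic N" "e \<in> etcs"
  shows "e + k * int N \<in> etcs"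
proof -
  let ?S = "etc_scan B a b lam u (int N) 1 {}"
  have *: "etcs = {e + k * int N | e k. e \<in> ?S}"
    using assms(1) by (simp add: ETC_def copies_def)
  with assms(2) obtain e' l where e': "e' \<in> ?S" "e = e' + l * int N" by auto
  then have "e + k * int N = e' + (l + k) * int N" by (simp add: algebra_simps)
  with e' show ?thesis unfolding * by blast
qed

text \<open>A drop by the positive amount \<open>2 / lam\<close> needs a nonzero value nearby.
  Finiteness gives \<open>Min\<close> and \<open>Max\<close> in \<open>ETC\<close> their
  meaning.\<close>

lemma finite_troubled:
  assumes "B = Compact_Support"
  shows "finite {j. troubled lam u j}"
proof -
  let ?S = "{j. u j \<noteq> 0}"
  have pos: "0 < 2 / lam" using lam ab by simp
  have "{j. troubled lam u j} \<subseteq> ?S \<union> (\<lambda>j. j + 1) ` ?S \<union> (\<lambda>j. j - 1) ` ?S"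
  proof
    fix j assume "j \<in> {j. troubled lam u j}"
    then have "u (j - 1) \<noteq> 0 \<or> u j \<noteq> 0 \<or> u (j + 1) \<noteq> 0"
      using pos by (auto simp: troubled_iff_has_drop has_drop_def)
    moreover have "j = (j - 1) + 1" "j = (j + 1) - 1" by auto
    ultimately show "j \<in> ?S \<union> (\<lambda>j. j + 1) ` ?S \<union> (\<lambda>j. j - 1) ` ?S" by blast
  qed
  moreover have "finite ?S" using grid assms by (simp add: grid_condition_def)
  ultimately show ?thesis by (meson finite_UnI finite_imageI finite_subset)
qed

lemma etcs_troubled:
  assumes "e \<in> etcs"
  shows "troubled lam u e"
proof (cases B)
  case (Periodic N)
  then obtain e' l where e': "e' \<in> etc_scan B a b lam u (int N) 1 {}" and "e = e' + l * int N"
    using assms by (auto simp: ETC_def copies_def)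
  then show ?thesis
    using etc_scan_troubled[OF _ e'] troubled_periodic[OF Periodic] by simp
next
  case Compact_Support
  then show ?thesis
    using assms etc_scan_troubled[of "{}"] by (auto simp: ETC_def Let_def split: if_splits)
qed

lemma etcs_cover:
  assumes "troubled lam u k"
  shows "\<exists>e\<in>etcs. k \<in> block (region e)"
proof (cases B)
  case (Periodic N)
  then have N: "N \<ge> 1" using grid by (simp add: grid_condition_def)
  \<comment> \<open>\<open>k'\<close> is the periodic copy of \<open>k\<close> in the scanned range,
    which starts at 1 rather than 0.\<close>
  define l where "l = (k - 1) div int N"
  define k' where "k' = k - l * int N"
  have "k' = (k - 1) mod int N + 1"
    using div_mult_mod_eq[of "k - 1" "int N"] unfolding k'_def l_def by linarith
  then have k': "1 \<le> k'" "k' \<le> int N"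
    using pos_mod_bound[of "int N" "k - 1"] pos_mod_sign[of "int N" "k - 1"] N by linarith+
  have "troubled lam u k'"
    using assms troubled_periodic[OF Periodic, of k' l] by (simp add: k'_def)
  then obtain e where e: "e \<in> etcs" "k' \<in> block (region e)"
    using etc_scan_covers[OF ab _ k', of lam u B "{}"] Periodic by (auto simp: ETC_def)
  then have "k \<in> block (region (e + l * int N))"
    unfolding region_periodic[OF Periodic] by (cases "region e") (auto simp: k'_def)
  then show ?thesis using etcs_periodic[OF Periodic e(1)] by blast
next
  case Compact_Support
  let ?T = "{j. troubled lam u j}"
  have "Min ?T \<le> k" "k \<le> Max ?T"
    using finite_troubled[OF Compact_Support] assms by auto
  then show ?thesis
    using etc_scan_covers[OF ab assms, of "Min ?T" "Max ?T" B "{}"] Compact_Support assms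
    by (auto simp: ETC_def copies_def Let_def)
qed

lemma mesh_cases:
  assumes "(p, q) \<in> mesh"
  obtains (merged) e where "e \<in> etcs" "region e = (p, q)"
  | (single) "q = p" "\<not> troubled lam u p"
  using assms etcs_cover that unfolding merged_mesh_def Let_def by fastforce

lemma mesh_admissible:
  assumes "(p, q) \<in> mesh"
  shows "admissible_block ((a + b) / 2) ((a - b) / 2) u p q"
  using assms
proof (cases rule: mesh_cases)
  case (merged e)
  then show ?thesis using admissible_influence_region[OF ab lam etcs_troubled] by blast
next
  case single
  then show ?thesis using admissible_untroubled[OF lam] by simp
qed

lemma mesh_size:
  assumes "(p, q) \<in> mesh"
  shows "p \<le> q" "q \<le> p + 6"
  using assms
  by (cases rule: mesh_cases; use influence_region_bounds[OF ab] in fastforce)+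

lemma dt_bound: "(a - b) * dt < 4 * dx"
  using cfl ab by (simp add: lam field_simps)

lemma nu_range: "b \<le> nu u j" "nu u j \<le> a"
  using range[of j] range[of "j + 1"] by (auto simp: nu_def)

text \<open>The ends approach each other by less than \<open>4 * dx\<close>, and a merged block has
  at least four cells. For an untroubled cell the speeds differ by at most
  \<open>(a - b) / 4\<close>, so the approach stays below \<open>dx\<close>.\<close>

lemma cell_star_length_pos:
  assumes "(p, q) \<in> mesh"
  shows "0 < cell_star_length dx dt u (p, q)"
  using assms
proof (cases rule: mesh_cases)
  case (merged e)
  then have "of_int 4 \<le> (of_int (q - p + 1) :: real)"
    using influence_region_bounds[OF ab merged(2)] by (intro of_int_le_iff[THEN iffD2]) simp
  then have "4 * dx \<le> of_int (q - p + 1) * dx"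
    using dx by (intro mult_right_mono) auto
  moreover have "(nu u (p - 1) - nu u q) * dt \<le> (a - b) * dt"
    using nu_range[of q] nu_range[of "p - 1"] dt by (intro mult_right_mono) auto
  ultimately show ?thesis using dt_bound by (simp add: algebra_simps)
next
  case single
  have "nu u (p - 1) - nu u p \<le> (a - b) / 4"
    using single(2) by (auto simp: nu_def troubled_iff_has_drop has_drop_def lam field_simps)
  then have "(nu u (p - 1) - nu u p) * dt \<le> (a - b) / 4 * dt"
    using dt by (intro mult_right_mono) auto
  then show ?thesis using dt_bound single(1) by (simp add: algebra_simps)
qed

lemma mesh_cover: "\<exists>K\<in>mesh. j \<in> block K"
proof (cases "\<exists>K\<in>region ` etcs. j \<in> block K")
  case False
  then have "(j, j) \<in> mesh" by (auto simp: merged_mesh_def Let_def)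
  then show ?thesis by (intro bexI[of _ "(j, j)"]) auto
qed (auto simp: merged_mesh_def Let_def)

text \<open>Isolation of the ETCs separates the merged blocks; single cells avoid them by
  construction.\<close>

lemma mesh_disjoint:
  assumes "K \<in> mesh" "K' \<in> mesh" "j \<in> block K" "j \<in> block K'"
  shows "K = K'"
proof -
  have "region e = region e'" if "e \<in> etcs" "e' \<in> etcs" "j \<in> block (region e)" "j \<in> block (region e')" for e e'
    using isolated[OF that(1)] that unfolding isolated_ETC_def by (cases "e' = e") auto
  then show ?thesis using assms unfolding merged_mesh_def Let_def by auto
qed

lemma mesh_periodic:
  assumes N: "B = Periodic N" and K: "(p, q) \<in> mesh"
  shows "(p + k * int N, q + k * int N) \<in> mesh"
proof -
  let ?R = "region ` etcs"
  have shift: "(i + l * int N, j + l * int N) \<in> ?R" if R: "(i, j) \<in> ?R" for i j l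
  proof -
    obtain e where e: "e \<in> etcs" "region e = (i, j)" using R by auto
    then have "region (e + l * int N) = (i + l * int N, j + l * int N)"
      using region_periodic[OF N] by simp
    then show ?thesis using etcs_periodic[OF N e(1)] by (metis imageI)
  qed
  show ?thesis
  proof (cases "(p, q) \<in> ?R")
    case True
    then show ?thesis using shift by (auto simp: merged_mesh_def Let_def)
  next
    case False
    then have q: "q = p" and p: "\<And>K. K \<in> ?R \<Longrightarrow> p \<notin> block K"
      using K by (auto simp: merged_mesh_def Let_def)
    have "p + k * int N \<notin> block K" if K: "K \<in> ?R" for K
    proof
      assume *: "p + k * int N \<in> block K"
      obtain i j where ij: "K = (i, j)" by force
      have "p \<in> block (i + (- k) * int N, j + (- k) * int N)" using * ij by auto
      moreover have "(i + (- k) * int N, j + (- k) * int N) \<in> ?R"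
        using shift[of i j "- k"] K ij by simp
      ultimately show False using p by blast
    qed
    then show ?thesis using q by (auto simp: merged_mesh_def Let_def)
  qed
qed

section \<open>Order of the moved interfaces and covering of the line\<close>

abbreviation "y \<equiv> edge_star x0 dx dt u"

lemma y_incr:
  assumes "(p, q) \<in> mesh"
  shows "y (p - 1) < y q"
  using cell_star_length_pos[OF assms] by (simp add: edge_star_def edge_def algebra_simps)

lemma mesh_next:
  assumes "(p, q) \<in> mesh"
  obtains q' where "(q + 1, q') \<in> mesh"
proof -
  obtain p' q' where K': "(p', q') \<in> mesh" "p' \<le> q + 1" "q + 1 \<le> q'"
    using mesh_cover[of "q + 1"] by auto
  have "p' = q + 1"
  proof (rule ccontr)
    assume "p' \<noteq> q + 1"
    then have "(p, q) = (p', q')"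
      using mesh_disjoint[OF assms K'(1), of q] K' mesh_size[OF assms] by auto
    with K' show False by simp
  qed
  with K' that show thesis by blast
qed

lemma mesh_linear:
  assumes "(p, q) \<in> mesh" "(p', q') \<in> mesh"
  shows "(p, q) = (p', q') \<or> q < p' \<or> q' < p"
  using mesh_disjoint[OF assms, of "max p p'"] mesh_size[OF assms(1)] mesh_size[OF assms(2)]
  by (auto simp: max_def split: if_splits)

lemma y_mono:
  assumes "(p, q) \<in> mesh" "(p', q') \<in> mesh" "q < p'"
  shows "y q \<le> y (p' - 1)"
  using assms
proof (induction "nat (p' - q)" arbitrary: p q rule: less_induct)
  case less
  obtain q2 where K2: "(q + 1, q2) \<in> mesh" using mesh_next[OF less.prems(1)] .
  show ?case
  proof (cases "p' = q + 1")
    case False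
    then have "q2 < p'"
      using mesh_linear[OF K2 less.prems(2)] less.prems(3) mesh_size[OF less.prems(2)] by auto
    then have "y q2 \<le> y (p' - 1)"
      using less.hyps[OF _ K2 less.prems(2)] mesh_size[OF K2] less.prems(3) by simp
    then show ?thesis using y_incr[OF K2] by simp
  qed simp
qed

lemma cell_star_unique:
  assumes "K \<in> mesh" "K' \<in> mesh" "x \<in> cell_star x0 dx dt u K" "x \<in> cell_star x0 dx dt u K'"
  shows "K = K'"
proof -
  obtain p q p' q' where K: "K = (p, q)" "K' = (p', q')" by force
  show ?thesis
    using mesh_linear[of p q p' q'] y_mono[of p q p' q'] y_mono[of p' q' p q] assms K by auto
qed

definition max_shift where "max_shift = (\<bar>a\<bar> + \<bar>b\<bar>) * dt"

lemma y_near: "\<bar>y j - (x0 + of_int j * dx)\<bar> \<le> max_shift"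
proof -
  have "\<bar>nu u j\<bar> \<le> \<bar>a\<bar> + \<bar>b\<bar>" using nu_range[of j] by auto
  then show ?thesis using dt by (simp add: edge_star_def edge_def max_shift_def abs_mult)
qed

lemma ex_mesh_right:
  obtains p q where "(p, q) \<in> mesh" "y q > x"
proof -
  obtain j where j: "x0 + of_int j * dx - max_shift > x"
  proof
    show "x0 + of_int (\<lceil>(x + max_shift - x0) / dx\<rceil> + 1) * dx - max_shift > x"
    proof -
      have "(x + max_shift - x0) / dx < of_int (\<lceil>(x + max_shift - x0) / dx\<rceil> + 1)" by linarith
      then show ?thesis using dx by (simp add: pos_divide_less_eq algebra_simps)
    qed
  qed
  obtain p q where K: "(p, q) \<in> mesh" "j \<le> q" using mesh_cover[of j] by auto
  have "of_int j * dx \<le> of_int q * dx" using K dx by (intro mult_right_mono) auto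
  then show thesis using that K j y_near[of q] by (auto simp: abs_le_iff)
qed

lemma ex_mesh_left:
  obtains p q where "(p, q) \<in> mesh" "y q \<le> x"
proof -
  \<comment> \<open>By \<open>mesh_size\<close> the block containing \<open>j\<close> ends at
    \<open>j + 6\<close> at the latest.\<close>
  obtain j where j: "x0 + of_int (j + 6) * dx + max_shift \<le> x"
  proof
    show "x0 + of_int (\<lfloor>(x - max_shift - x0) / dx\<rfloor> - 6 + 6) * dx + max_shift \<le> x"
    proof -
      have "of_int (\<lfloor>(x - max_shift - x0) / dx\<rfloor>) \<le> (x - max_shift - x0) / dx" by linarith
      then have "of_int (\<lfloor>(x - max_shift - x0) / dx\<rfloor>) * dx \<le> x - max_shift - x0"
        using dx by (simp only: pos_le_divide_eq)
      then show ?thesis by simp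
    qed
  qed
  obtain p q where K: "(p, q) \<in> mesh" "p \<le> j" using mesh_cover[of j] by auto
  have "of_int q * dx \<le> of_int (j + 6) * dx"
    using K dx mesh_size[OF K(1)] by (intro mult_right_mono) (simp_all only: of_int_le_iff)
  then show thesis using that K j y_near[of q] by (auto simp: abs_le_iff)
qed

text \<open>The last right end that has moved to a point not beyond \<open>x\<close> is followed by
  the block containing \<open>x\<close>. A block ending beyond \<open>x\<close> keeps the set of
  candidates finite.\<close>

lemma cell_star_cover: "\<exists>K\<in>mesh. x \<in> cell_star x0 dx dt u K"
proof -
  obtain p1 q1 where K1: "(p1, q1) \<in> mesh" "y q1 > x" by (rule ex_mesh_right)
  obtain p0 q0 where K0: "(p0, q0) \<in> mesh" "y q0 \<le> x" by (rule ex_mesh_left)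
  define S where "S = {q. (\<exists>p. (p, q) \<in> mesh) \<and> y q \<le> x \<and> q0 \<le> q}"
  have "S \<subseteq> {q0..q1}"
  proof
    fix q assume "q \<in> S"
    then obtain p where K: "(p, q) \<in> mesh" "y q \<le> x" "q0 \<le> q" by (auto simp: S_def)
    have "\<not> q1 < p"
      using y_mono[OF K1(1) K(1)] y_incr[OF K(1)] K K1 by linarith
    then have "q \<le> q1"
      using mesh_linear[OF K(1) K1(1)] mesh_size[OF K1(1)] by auto
    with K show "q \<in> {q0..q1}" by simp
  qed
  then have fin: "finite S" by (rule finite_subset) simp
  have "q0 \<in> S" using K0 by (auto simp: S_def)
  define q where "q = Max S"
  have "q \<in> S" using fin \<open>q0 \<in> S\<close> Max_in by (auto simp: q_def)
  then obtain p where K: "(p, q) \<in> mesh" "y q \<le> x" "q0 \<le> q" by (auto simp: S_def)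
  obtain q' where K': "(q + 1, q') \<in> mesh" using mesh_next[OF K(1)] .
  have "q' \<notin> S" using Max_ge[OF fin, of q'] mesh_size[OF K'] by (auto simp: q_def[symmetric])
  then have "x < y q'" using K' K mesh_size[OF K'] by (auto simp: S_def)
  then show ?thesis using K K' by (intro bexI[of _ "(q + 1, q')"]) auto
qed

definition cell_at :: "real \<Rightarrow> int \<times> int" where
  "cell_at x = (THE K. K \<in> mesh \<and> x \<in> cell_star x0 dx dt u K)"

lemma cell_at_eq:
  assumes "K \<in> mesh" "x \<in> cell_star x0 dx dt u K"
  shows "cell_at x = K"
  unfolding cell_at_def using assms cell_star_unique by blast

lemma cell_at_mem: "cell_at x \<in> mesh" "x \<in> cell_star x0 dx dt u (cell_at x)"
  using cell_star_cover[of x] cell_at_eq by metis+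

lemma u_star_eq: "u_star B a b lam x0 dx dt u x = cell_star_value dx dt u (cell_at x)"
  by (simp add: u_star_def cell_at_def)

end


subsection \<open>The values on the merged mesh as values of the interpolant\<close>

lemma cell_star_value_le:
  assumes "admissible_block m r u p q" "p \<le> q" "0 \<le> r"
    and "\<And>i. m - r \<le> u i \<and> u i \<le> m + r" "c \<le> m + r"
    and "0 \<le> dt" "r * dt \<le> 2 * dx" "0 < cell_star_length dx dt u (p, q)"
    and "\<And>i. p \<le> i \<Longrightarrow> i \<le> q \<Longrightarrow> u i \<le> c" "(u q + u (q + 1)) / 2 \<le> c"
  shows "cell_star_value dx dt u (p, q) \<le> c"
proof -
  have "value_bounded r u p q c"
    using assms by (intro value_bounded_admissible)
  then have "dx * (\<Sum>i\<in>{p..q}. u i) - dt * (flux_hat u q - flux_hat u (p - 1))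
    \<le> c * cell_star_length dx dt u (p, q)"
    using assms by (intro numerator_nonpos[of r])
  then show ?thesis
    using assms(8) unfolding cell_star_value.simps by (simp only: pos_divide_le_eq)
qed

lemma cell_star_value_ge:
  assumes "admissible_block m r u p q" "p \<le> q" "0 \<le> r"
    and "\<And>i. m - r \<le> u i \<and> u i \<le> m + r" "m - r \<le> c"
    and "0 \<le> dt" "r * dt \<le> 2 * dx" "0 < cell_star_length dx dt u (p, q)"
    and "\<And>i. p \<le> i \<Longrightarrow> i \<le> q \<Longrightarrow> c \<le> u i" "c \<le> (u (p - 1) + u p) / 2"
  shows "c \<le> cell_star_value dx dt u (p, q)"
proof -
  have "cell_star_value dx dt (reflect u) (- q, - p) \<le> - c"
  proof (rule cell_star_value_le[OF admissible_block_reflect[OF assms(1)]])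
    show "- m - r \<le> reflect u i \<and> reflect u i \<le> - m + r" for i
      using assms(4)[of "- i"] by (simp add: reflect_def)
    show "reflect u i \<le> - c" if "- q \<le> i" "i \<le> - p" for i
      using assms(9)[of "- i"] that by (simp add: reflect_def)
    show "(reflect u (- p) + reflect u (- p + 1)) / 2 \<le> - c"
      using assms(10) by (simp add: reflect_def)
    show "0 < cell_star_length dx dt (reflect u) (- q, - p)"
      unfolding cell_star_value_reflect by (rule assms)
  qed (use assms in auto)
  then show ?thesis unfolding cell_star_value_reflect by simp
qed

context el_step
begin

text \<open>The interval contains all cell centres and both interfaces, so the maximum and minimum
  of \<open>lin u\<close> over it are admissible choices of \<open>c\<close> in the two bounds. The
  intermediate value theorem gives the point.\<close>

lemma value_attained:
  assumes K: "(p, q) \<in> mesh"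
  shows "\<exists>t. 0 \<le> t \<and> t \<le> of_int (q - p + 1)
    \<and> lin u (of_int p - 1 / 2 + t) = cell_star_value dx dt u (p, q)"
proof -
  let ?m = "(a + b) / 2" and ?r = "(a - b) / 2"
  define S where "S = {of_int p - 1 / 2 .. of_int q + 1 / 2 :: real}"
  have pq: "p \<le> q" by (rule mesh_size[OF K])
  then have real_pq: "(of_int p :: real) \<le> of_int q" by simp
  have "\<bar>u (j + 1) - u j\<bar> \<le> a - b" for j
    using range[of j] range[of "j + 1"] by (simp add: abs_le_iff)
  then have cont: "continuous_on T (lin u)" for T by (rule lin_continuous)
  have S: "compact S" "S \<noteq> {}" using real_pq by (auto simp: S_def)
  obtain s1 where s1: "s1 \<in> S" "\<And>s. s \<in> S \<Longrightarrow> lin u s \<le> lin u s1"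
    using continuous_attains_sup[OF S cont] by blast
  obtain s0 where s0: "s0 \<in> S" "\<And>s. s \<in> S \<Longrightarrow> lin u s0 \<le> lin u s"
    using continuous_attains_inf[OF S cont] by blast
  have cells: "of_int i \<in> S" if "p \<le> i" "i \<le> q" for i
  proof -
    have "(of_int p :: real) \<le> of_int i" "(of_int i :: real) \<le> of_int q" using that by auto
    then show ?thesis unfolding S_def by auto
  qed
  have ends: "lin u (of_int p - 1 / 2) = (u (p - 1) + u p) / 2"
    "lin u (of_int q + 1 / 2) = (u q + u (q + 1)) / 2"
    using lin_half[of u "p - 1"] lin_half[of u q] by (simp_all add: field_simps)
  have "of_int p - 1 / 2 \<in> S" "of_int q + 1 / 2 \<in> S" using real_pq by (auto simp: S_def)
  note mid = s0(2)[OF this(1), unfolded ends] s1(2)[OF this(2), unfolded ends]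
  have range': "?m - ?r \<le> u i \<and> u i \<le> ?m + ?r" for i
    using range[of i] by (simp add: field_simps)
  have lin_range: "b \<le> lin u s" "lin u s \<le> a" for s
    using lin_le[of "\<lambda>_. b" u s] lin_le[of u "\<lambda>_. a" s] range by (auto simp: lin_const)
  have r: "0 \<le> ?r" "?r * dt \<le> 2 * dx" using ab dt_bound by auto
  have "cell_star_value dx dt u (p, q) \<le> lin u s1"
  proof (rule cell_star_value_le[OF mesh_admissible[OF K] pq r(1) range' _ _ r(2)
        cell_star_length_pos[OF K]])
    show "lin u s1 \<le> ?m + ?r" using lin_range[of s1] by (simp add: field_simps)
    show "u i \<le> lin u s1" if "p \<le> i" "i \<le> q" for i
      using s1(2)[OF cells[OF that]] by simp
  qed (use dt mid in auto)
  moreover have "lin u s0 \<le> cell_star_value dx dt u (p, q)"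
  proof (rule cell_star_value_ge[OF mesh_admissible[OF K] pq r(1) range' _ _ r(2)
        cell_star_length_pos[OF K]])
    show "?m - ?r \<le> lin u s0" using lin_range[of s0] by (simp add: field_simps)
    show "lin u s0 \<le> u i" if "p \<le> i" "i \<le> q" for i
      using s0(2)[OF cells[OF that]] by simp
  qed (use dt mid in auto)
  moreover have "connected (lin u ` S)"
    unfolding S_def by (intro connected_continuous_image cont) auto
  ultimately have "cell_star_value dx dt u (p, q) \<in> lin u ` S"
    using s0(1) s1(1) unfolding connected_iff_interval by blast
  then obtain s where "s \<in> S" "lin u s = cell_star_value dx dt u (p, q)" by auto
  then show ?thesis
    by (intro exI[of _ "s - (of_int p - 1 / 2)"]) (auto simp: S_def)
qed

text \<open>In the periodic case the predicate below is the same for a block and its translates, so the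
  choice made by \<open>SOME\<close> is the same as well and \<open>xi\<close> commutes with the period.\<close>

definition offset :: "int \<Rightarrow> int \<Rightarrow> real" where
  "offset p q = (SOME t. 0 \<le> t \<and> t \<le> of_int (q - p + 1)
    \<and> lin u (of_int p - 1 / 2 + t) = cell_star_value dx dt u (p, q))"

definition xi :: "real \<Rightarrow> real" where
  "xi x = (case cell_at x of (p, q) \<Rightarrow> of_int p - 1 / 2 + offset p q)"

lemma offset:
  assumes "(p, q) \<in> mesh"
  shows "0 \<le> offset p q" "offset p q \<le> of_int (q - p + 1)"
    "lin u (of_int p - 1 / 2 + offset p q) = cell_star_value dx dt u (p, q)"
  using someI_ex[OF value_attained[OF assms]] unfolding offset_def[symmetric] by auto

lemma u_star_eq_lin: "u_star B a b lam x0 dx dt u x = lin u (xi x)"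
  using cell_at_mem(1)[of x] offset(3)
  by (cases "cell_at x") (simp add: u_star_eq xi_def)

lemma xi_bounds:
  assumes "cell_at x = (p, q)"
  shows "of_int p - 1 / 2 \<le> xi x" "xi x \<le> of_int q + 1 / 2"
  using offset[of p q] cell_at_mem(1)[of x] assms by (auto simp: xi_def)

text \<open>\<open>xi\<close> is constant on each moved block, and the intervals of different blocks
  share at most an interface.\<close>

lemma mono_xi: "mono xi"
proof
  fix x x' :: real assume le: "x \<le> x'"
  obtain p q p' q' where K: "cell_at x = (p, q)" "cell_at x' = (p', q')" by force
  have mem: "(p, q) \<in> mesh" "(p', q') \<in> mesh"
    "y (p - 1) \<le> x" "x < y q" "y (p' - 1) \<le> x'" "x' < y q'"
    using cell_at_mem[of x] cell_at_mem[of x'] K by auto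
  have "\<not> q' < p"
    using y_mono[OF mem(2,1)] mem le by auto
  then consider "(p, q) = (p', q')" | "q < p'"
    using mesh_linear[OF mem(1,2)] by blast
  then show "xi x \<le> xi x'"
  proof cases
    case 1
    then show ?thesis using K by (simp add: xi_def)
  next
    case 2
    then have "(of_int q :: real) + 1 \<le> of_int p'" by linarith
    then show ?thesis using xi_bounds[OF K(1)] xi_bounds[OF K(2)] by linarith
  qed
qed

text \<open>Finite speed of propagation, used to preserve compact support; the multiple of
  \<open>dx\<close> allows for the size of a block.\<close>

lemma xi_near: "\<bar>dx * xi x - (x - x0)\<bar> \<le> max_shift + 8 * dx"
proof -
  obtain p q where K: "cell_at x = (p, q)" by force
  have mem: "(p, q) \<in> mesh" "y (p - 1) \<le> x" "x < y q"
    using cell_at_mem[of x] K by auto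
  have "dx * (of_int p - 1 / 2) \<le> dx * xi x" "dx * xi x \<le> dx * (of_int q + 1 / 2)"
    using xi_bounds[OF K] dx by (auto intro!: mult_left_mono)
  moreover have "dx * of_int q \<le> dx * (of_int p + 6)"
    using mesh_size(2)[OF mem(1)] dx by (intro mult_left_mono) linarith+
  ultimately show ?thesis
    using y_near[of "p - 1"] y_near[of q] mem(2,3) dx by (auto simp: abs_le_iff algebra_simps)
qed

lemma xi_periodic:
  assumes N: "B = Periodic N"
  shows "xi (x + real N * dx) = xi x + real N"
proof -
  obtain p q where K: "cell_at x = (p, q)" by force
  have mem: "(p, q) \<in> mesh" "x \<in> cell_star x0 dx dt u (p, q)"
    using cell_at_mem[of x] K by auto
  have per: "u (j + int N) = u j" for j using periodic[OF N, of j 1] by simp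
  then have per': "u (j + int N + 1) = u (j + 1)" for j
    using per[of "j + 1"] by (simp add: algebra_simps)
  have nu: "nu u (j + int N) = nu u j" for j by (simp add: nu_def per per')
  have fl: "flux_hat u (j + int N) = flux_hat u j" for j
    by (simp add: flux_hat_def flux_def alpha_def nu per per')
  have y: "y (j + int N) = y j + real N * dx" for j
    by (simp add: edge_star_def edge_def nu algebra_simps)
  have "(p + int N, q + int N) \<in> mesh" using mesh_periodic[OF N mem(1), of 1] by simp
  moreover have "x + real N * dx \<in> cell_star x0 dx dt u (p + int N, q + int N)"
    using mem(2) y[of "p - 1"] y[of q] by (simp add: algebra_simps)
  ultimately have cell: "cell_at (x + real N * dx) = (p + int N, q + int N)" by (rule cell_at_eq)
  have "(\<Sum>i\<in>{p + int N..q + int N}. u i) = (\<Sum>i\<in>{p..q}. u i)"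
    by (rule sum.reindex_bij_witness[of _ "\<lambda>i. i + int N" "\<lambda>i. i - int N"])
      (use per[of "_ - int N"] in auto)
  then have val: "cell_star_value dx dt u (p + int N, q + int N) = cell_star_value dx dt u (p, q)"
    using nu[of q] nu[of "p - 1"] fl[of q] fl[of "p - 1"] by (simp add: algebra_simps)
  have "lin u (of_int (p + int N) - 1 / 2 + t) = lin u (of_int p - 1 / 2 + t)" for t
    using lin_shift[of u "of_int p - 1 / 2 + t" "int N"] per by (simp add: algebra_simps)
  then have "offset (p + int N) (q + int N) = offset p q"
    by (simp only: offset_def val) simp
  then show ?thesis using K cell by (simp add: xi_def)
qed

end


subsection \<open>Total variation and boundary conditions\<close>

text \<open>The growth over one period does not depend on the starting cell, so it may be computed
  from cell 1.\<close>

lemma cumulated_variation_periodic: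
  assumes "\<And>j. u (j + int N) = u j"
  shows "cumulated_variation u (j + int N)
    = cumulated_variation u j + (\<Sum>k\<in>{1..int N}. \<bar>u (k + 1) - u k\<bar>)"
proof -
  let ?D = "\<lambda>j. cumulated_variation u (j + int N) - cumulated_variation u j"
  have step: "?D (j + 1) = ?D j" for j
    using cumulated_variation_step[of u "j + int N"] cumulated_variation_step[of u j]
      assms[of j] assms[of "j + 1"] by (simp add: add.commute add.left_commute)
  have "?D j = ?D 1"
  proof (induction j rule: int_induct[where k = 1])
    case (step1 i)
    then show ?case using step[of i] by linarith
  next
    case (step2 i)
    then show ?case using step[of "i - 1"] by simp
  qed simp
  moreover have "{1..<1 + int N} = {1..int N}" by auto
  ultimately show ?thesis
    using cumulated_variation_diff[of 1 "1 + int N" u] by simp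
qed

lemma cell_average_const: "dx > 0 \<Longrightarrow> cell_average x0 dx (\<lambda>x. c) j = c"
  by (rule antisym; rule cell_average_bounds) (auto simp: integrable_const_ivl)

lemma mono_integrable: "mono f \<Longrightarrow> f integrable_on {c..d::real}" for f :: "real \<Rightarrow> real"
  by (intro integrable_on_mono_on) (auto simp: mono_on_def mono_def)

text \<open>The sum over all cells is a supremum over finite sets, each contained in an interval of
  cells.\<close>

lemma TV_compact_le:
  assumes "\<And>i j. i \<le> j \<Longrightarrow> \<exists>k l. (\<Sum>m\<in>{i..<j}. \<bar>v (m + 1) - v m\<bar>) \<le> (\<Sum>m\<in>{k..<l}. \<bar>u (m + 1) - u m\<bar>)"
  shows "TV Compact_Support v \<le> TV Compact_Support u"
proof -
  have TV: "TV Compact_Support f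
      = (SUP F\<in>{F. finite F \<and> F \<subseteq> UNIV}. \<Sum>m\<in>F. ennreal \<bar>f (m + 1) - f m\<bar>)" for f
    by (simp add: TV_def nonneg_infsum_complete)
  have "(\<Sum>m\<in>F. ennreal \<bar>v (m + 1) - v m\<bar>) \<le> TV Compact_Support u" if "finite F" for F :: "int set"
  proof -
    obtain i j where ij: "i \<le> j" "F \<subseteq> {i..<j}"
    proof (cases "F = {}")
      case False
      have "Min F \<le> x" "x < Max F + 1" if "x \<in> F" for x
        using that \<open>finite F\<close> by (auto simp: zless_add1_eq order_le_less[symmetric])
      moreover from this have "Min F \<le> Max F + 1" using False \<open>finite F\<close> by (meson Max_in order.trans less_imp_le)
      ultimately have "F \<subseteq> {Min F..<Max F + 1}" "Min F \<le> Max F + 1" by auto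
      then show thesis using that by blast
    qed (use that[of 0 0] in auto)
    obtain k l where kl: "(\<Sum>m\<in>{i..<j}. \<bar>v (m + 1) - v m\<bar>) \<le> (\<Sum>m\<in>{k..<l}. \<bar>u (m + 1) - u m\<bar>)"
      using assms[OF ij(1)] by blast
    have "(\<Sum>m\<in>F. ennreal \<bar>v (m + 1) - v m\<bar>) \<le> (\<Sum>m\<in>{i..<j}. ennreal \<bar>v (m + 1) - v m\<bar>)"
      using ij(2) by (intro sum_mono2) auto
    also have "\<dots> \<le> (\<Sum>m\<in>{k..<l}. ennreal \<bar>u (m + 1) - u m\<bar>)"
      using kl by (simp add: sum_ennreal ennreal_leI)
    also have "\<dots> \<le> TV Compact_Support u"
      unfolding TV by (intro SUP_upper) auto
    finally show ?thesis .
  qed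
  then show ?thesis unfolding TV[of v] by (intro SUP_least) auto
qed

context el_step
begin

section \<open>Variation, range and support after one step\<close>

abbreviation "w \<equiv> u_star B a b lam x0 dx dt u"
abbreviation "step \<equiv> el_fv_step B a b lam x0 dx dt u"

definition "V x = lin (cumulated_variation u) (xi x)"

lemma mono_V: "mono V" "mono (\<lambda>x. V x + w x)" "mono (\<lambda>x. V x - w x)"
  using mono_xi mono_cumulated_variation[of u]
  unfolding V_def u_star_eq_lin by (auto simp: mono_def)

lemma w_integrable: "w integrable_on {c..d}"
proof -
  have "(\<lambda>x. (V x + w x) - V x) integrable_on {c..d}"
    by (intro integrable_diff mono_integrable mono_V)
  then show ?thesis by simp
qed

lemma step_variation:
  "\<bar>step (j + 1) - step j\<bar> \<le> cell_average x0 dx V (j + 1) - cell_average x0 dx V j"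
proof -
  have "cell_average x0 dx (\<lambda>x. V x + w x) i = cell_average x0 dx V i + step i"
    "cell_average x0 dx (\<lambda>x. V x - w x) i = cell_average x0 dx V i - step i" for i
    using w_integrable mono_integrable[OF mono_V(1)]
    by (simp_all add: el_fv_step_def cell_average_add cell_average_diff)
  then show ?thesis
    using cell_average_shift_mono[OF mono_V(2) dx, of x0 j]
      cell_average_shift_mono[OF mono_V(3) dx, of x0 j] by (simp add: abs_le_iff)
qed

lemma step_variation_sum:
  assumes "i \<le> j"
  shows "(\<Sum>k\<in>{i..<j}. \<bar>step (k + 1) - step k\<bar>) \<le> cell_average x0 dx V j - cell_average x0 dx V i"
  unfolding sum_telescope_int[OF assms, symmetric] by (intro sum_mono step_variation)

lemma w_range: "b \<le> w x" "w x \<le> a"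
  using lin_le[of "\<lambda>_. b" u "xi x"] lin_le[of u "\<lambda>_. a" "xi x"] range
  by (auto simp: lin_const u_star_eq_lin)

lemma step_range: "b \<le> step j" "step j \<le> a"
  unfolding el_fv_step_def
  by (auto intro!: cell_average_bounds dx w_integrable w_range)

lemma TV_step: "TV B step \<le> TV B u"
proof (cases B)
  case (Periodic N)
  let ?T = "\<Sum>k\<in>{1..int N}. \<bar>u (k + 1) - u k\<bar>"
  have per: "u (j + int N) = u j" for j using periodic[OF Periodic, of j 1] by simp
  have "lin (cumulated_variation u) (t + of_int (int N)) = lin (cumulated_variation u) t + ?T" for t
    unfolding lin_shift cumulated_variation_periodic[of u N, OF per] lin_add lin_const ..
  \<comment> \<open>Since \<open>xi\<close> advances by \<open>N\<close>, the telescoped sum over a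
    period is exactly \<open>?T\<close>.\<close>
  then have "V (x + of_int (int N) * dx) = V x + ?T" for x
    using xi_periodic[OF Periodic, of x] by (simp add: V_def)
  then have "cell_average x0 dx V (1 + int N) = cell_average x0 dx (\<lambda>x. V x + ?T) 1"
    unfolding cell_average_translate by simp
  also have "\<dots> = cell_average x0 dx V 1 + ?T"
    using mono_integrable[OF mono_V(1)]
    by (simp add: cell_average_add integrable_const_ivl cell_average_const dx)
  moreover have "{1..<1 + int N} = {1..int N}" by auto
  ultimately have "(\<Sum>k\<in>{1..int N}. \<bar>step (k + 1) - step k\<bar>) \<le> ?T"
    using step_variation_sum[of 1 "1 + int N"] by simp
  then show ?thesis
    using Periodic by (simp add: TV_def sum_ennreal ennreal_leI)
next
  case Compact_Support
  have "\<exists>k l. (\<Sum>m\<in>{i..<j}. \<bar>step (m + 1) - step m\<bar>)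
      \<le> (\<Sum>m\<in>{k..<l}. \<bar>u (m + 1) - u m\<bar>)" if ij: "i \<le> j" for i j
  proof -
    \<comment> \<open>Cells \<open>i\<close> to \<open>j\<close> extend from interface
      \<open>i - 1\<close> to \<open>j\<close>. Rounding \<open>xi\<close> outward gives integers,
      where the interpolant is the cumulated variation itself.\<close>
    define k where "k = \<lfloor>xi (edge x0 dx (i - 1))\<rfloor>"
    define l where "l = \<lceil>xi (edge x0 dx j)\<rceil>"
    have "edge x0 dx (i - 1) \<le> edge x0 dx j" using ij dx by (simp add: edge_def mult_right_mono)
    then have "xi (edge x0 dx (i - 1)) \<le> xi (edge x0 dx j)" by (rule monoD[OF mono_xi])
    then have kl: "k \<le> l" unfolding k_def l_def by linarith
    let ?c = "cumulated_variation u"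
    have k: "?c k \<le> V x" if "edge x0 dx (i - 1) \<le> x" for x
    proof -
      have "of_int k \<le> xi x" using monoD[OF mono_xi that] unfolding k_def by linarith
      then show ?thesis using monoD[OF mono_cumulated_variation(1)] unfolding V_def by fastforce
    qed
    have l: "V x \<le> ?c l" if "x \<le> edge x0 dx j" for x
    proof -
      have "xi x \<le> of_int l" using monoD[OF mono_xi that] unfolding l_def by linarith
      then show ?thesis using monoD[OF mono_cumulated_variation(1)] unfolding V_def by fastforce
    qed
    have "?c k \<le> cell_average x0 dx V i"
      using k l by (intro cell_average_bounds(1)[where a = "V (edge x0 dx i)"] dx
          mono_integrable mono_V) (auto intro: monoD[OF mono_V(1)])
    moreover have "cell_average x0 dx V j \<le> ?c l"
      using k l by (intro cell_average_bounds(2)[where b = "V (edge x0 dx (j - 1))"] dx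
          mono_integrable mono_V) (auto intro: monoD[OF mono_V(1)])
    ultimately show ?thesis
      using step_variation_sum[OF ij] cumulated_variation_diff[OF kl, of u]
      by (intro exI[of _ k] exI[of _ l]) linarith
  qed
  then show ?thesis unfolding Compact_Support by (rule TV_compact_le)
qed

lemma grid_step: "grid_condition B step"
proof (cases B)
  case (Periodic N)
  have "u (j + int N) = u j" for j using periodic[OF Periodic, of j 1] by simp
  then have "lin u (t + of_int (int N)) = lin u t" for t unfolding lin_shift by simp
  then have "w (x + of_int (int N) * dx) = w x" for x
    using xi_periodic[OF Periodic, of x] by (simp add: u_star_eq_lin)
  then have "step (j + int N) = step j" for j
    unfolding el_fv_step_def cell_average_translate by simp
  then show ?thesis using grid Periodic by (simp add: grid_condition_def)
next
  case Compact_Support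
  then have "finite {j. u j \<noteq> 0}" using grid by (simp add: grid_condition_def)
  then have "finite (abs ` {j. u j \<noteq> 0})" by simp
  then obtain R where R: "\<And>j. u j \<noteq> 0 \<Longrightarrow> \<bar>j\<bar> \<le> R"
    by (metis (mono_tags, lifting) Max_ge imageI mem_Collect_eq)
  have lin0: "lin u t = 0" if "\<bar>t\<bar> > of_int R + 1" for t
  proof -
    have "\<not> \<bar>\<lfloor>t\<rfloor>\<bar> \<le> R" "\<not> \<bar>\<lfloor>t\<rfloor> + 1\<bar> \<le> R" using that by linarith+
    then have "u \<lfloor>t\<rfloor> = 0" "u (\<lfloor>t\<rfloor> + 1) = 0" using R by blast+
    then show ?thesis by (simp add: lin_def)
  qed
  \<comment> \<open>The 11 covers the 8 of \<open>xi_near\<close>, one cell width and the 1 in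
    \<open>lin0\<close>, with one to spare.\<close>
  define M where "M = \<lceil>of_int R + 11 + max_shift / dx\<rceil>"
  have "step j = 0" if "\<not> \<bar>j\<bar> \<le> M" for j
  proof -
    have "of_int \<bar>j\<bar> > of_int R + 11 + max_shift / dx" using that unfolding M_def by linarith
    then have "(of_int R + 11 + max_shift / dx) * dx < of_int \<bar>j\<bar> * dx"
      using dx by (intro mult_strict_right_mono)
    then have big: "of_int R * dx + 11 * dx + max_shift < \<bar>of_int j\<bar> * dx"
      using dx by (simp add: algebra_simps)
    have "w x = 0" if "edge x0 dx (j - 1) \<le> x" "x \<le> edge x0 dx j" for x
    proof -
      have "\<bar>(x - x0) - of_int j * dx\<bar> \<le> dx"
        using that dx by (auto simp: edge_def abs_le_iff algebra_simps)
      moreover have "\<bar>of_int j\<bar> * dx = \<bar>of_int j * dx\<bar>" using dx by (simp add: abs_mult)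
      ultimately have "of_int R * dx + dx < \<bar>dx * xi x\<bar>"
        using big xi_near[of x] dx by linarith
      then have "(of_int R + 1) * dx < \<bar>xi x\<bar> * dx"
        using dx by (simp add: abs_mult algebra_simps)
      then have "of_int R + 1 < \<bar>xi x\<bar>" using dx by simp
      then show ?thesis using lin0 by (simp add: u_star_eq_lin)
    qed
    then have "0 \<le> step j" "step j \<le> 0"
      unfolding el_fv_step_def using dx w_integrable
      by (auto intro!: cell_average_bounds)
    then show ?thesis by simp
  qed
  then have "{j. step j \<noteq> 0} \<subseteq> {- M..M}" by (auto simp: abs_le_iff) (smt (verit))+
  then show ?thesis
    using Compact_Support finite_subset by (auto simp: grid_condition_def)
qed

end

text \<open>In the compact case \<open>M\<close> allows for the origin \<open>x0\<close> and one
  cell width, so that cells beyond it miss the support of \<open>u0\<close>.\<close>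

lemma grid_cell_average:
  assumes "dx > 0" "boundary_condition B dx u0" "\<And>c d. u0 integrable_on {c..d}"
  shows "grid_condition B (cell_average x0 dx u0)"
proof (cases B)
  case (Periodic N)
  then have "cell_average x0 dx u0 (j + int N) = cell_average x0 dx u0 j" for j
    using assms(2) unfolding cell_average_translate by (simp add: boundary_condition_def)
  then show ?thesis using assms(2) Periodic by (simp add: grid_condition_def boundary_condition_def)
next
  case Compact_Support
  then have "bounded {x. u0 x \<noteq> 0}"
    using assms(2) compact_imp_bounded bounded_subset closure_subset
    by (fastforce simp: boundary_condition_def)
  then obtain R where R: "\<And>x. u0 x \<noteq> 0 \<Longrightarrow> \<bar>x\<bar> \<le> R"
    by (auto simp: bounded_iff)
  define M where "M = \<lceil>(\<bar>R\<bar> + \<bar>x0\<bar> + dx) / dx\<rceil>"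
  have "cell_average x0 dx u0 j = 0" if "\<not> \<bar>j\<bar> \<le> M" for j
  proof -
    have "of_int \<bar>j\<bar> > (\<bar>R\<bar> + \<bar>x0\<bar> + dx) / dx" using that unfolding M_def by linarith
    then have big: "\<bar>R\<bar> + \<bar>x0\<bar> + dx < \<bar>of_int j * dx\<bar>"
      using assms(1) by (simp add: pos_divide_less_eq abs_mult)
    have "u0 x = 0" if "edge x0 dx (j - 1) \<le> x" "x \<le> edge x0 dx j" for x
    proof (rule ccontr)
      assume "u0 x \<noteq> 0"
      then have "\<bar>x\<bar> \<le> R" by (rule R)
      moreover have "\<bar>(x - x0) - of_int j * dx\<bar> \<le> dx"
        using that assms(1) by (auto simp: edge_def abs_le_iff algebra_simps)
      ultimately show False using big by linarith
    qed
    then have "0 \<le> cell_average x0 dx u0 j" "cell_average x0 dx u0 j \<le> 0"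
      using assms(1,3) by (auto intro!: cell_average_bounds)
    then show ?thesis by simp
  qed
  then have "{j. cell_average x0 dx u0 j \<noteq> 0} \<subseteq> {- M..M}"
    by (auto simp: abs_le_iff) (smt (verit))+
  then show ?thesis
    using Compact_Support finite_subset by (auto simp: grid_condition_def)
qed

theorem theorem3p1:
  fixes u0 :: "real \<Rightarrow> real" and a b lam x0 dx dt :: real and B :: boundary
    and U :: "nat \<Rightarrow> int \<Rightarrow> real"
  assumes "U = el_fv B a b lam x0 dx dt u0"
    and "dx > 0" and "dt > 0"
    and "a > b" and "\<forall>x. b \<le> u0 x \<and> u0 x \<le> a"
    and "\<forall>c d. u0 integrable_on {c..d}"
    and "boundary_condition B dx u0"
    and "lam = 4 / (a - b)" and "dt < lam * dx"
    and "\<forall>n. \<forall>e\<in>ETC B a b lam (U n). isolated_ETC B a b lam (U n) e"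
  shows "(\<forall>n. TV B (U (Suc n)) \<le> TV B (U n)) \<and>
         (\<forall>n>0. \<forall>j. b \<le> U n j \<and> U n j \<le> a)"
proof -
  have Suc: "U (Suc n) = el_fv_step B a b lam x0 dx dt (U n)" for n
    by (simp add: assms(1))
  have step: "el_step B a b lam dx dt (U n)"
    if "\<forall>j. b \<le> U n j \<and> U n j \<le> a" "grid_condition B (U n)" for n
    using that assms by unfold_locales auto
  \<comment> \<open>The two invariants are carried jointly, as both are assumptions of
    \<open>el_step\<close>.\<close>
  have inv: "(\<forall>j. b \<le> U n j \<and> U n j \<le> a) \<and> grid_condition B (U n)" for n
  proof (induction n)
    case 0
    have "b \<le> cell_average x0 dx u0 j" "cell_average x0 dx u0 j \<le> a" for j
      using assms(2,5,6) by (auto intro!: cell_average_bounds)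
    then show ?case
      using grid_cell_average assms(1,2,6,7) by simp
  next
    case (Suc n)
    then interpret el_step B a b lam x0 dx dt "U n" using step by blast
    show ?case unfolding \<open>U (Suc n) = _\<close> using step_range grid_step by blast
  qed
  have "TV B (U (Suc n)) \<le> TV B (U n)" for n
  proof -
    interpret el_step B a b lam x0 dx dt "U n" using step inv by blast
    show ?thesis unfolding Suc by (rule TV_step)
  qed
  with inv show ?thesis by blast
qed

end
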